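(* Let $0<s<\infty$ and let $\mu$ be a finite positive Borel measure on $[0,1)$. Let $\max\{1,\frac1s\}<p<\infty$ and let $X$ be a subspace of $H(\mathbb{D})$ with $\Lambda^p_{1/p}\subseteq X\subseteq\mathcal{B}$. Then $\mathcal{C}_{\mu,s}(H^\infty)\subseteq X$ if and only if $\mu$ is an $s$-Carleson measure on $[0,1)$.
   Context: Let $\mathbb{D}$ be the open unit disk in $\mathbb{C}$, let $H(\mathbb{D})$ be the space of analytic functions in $\mathbb{D}$, and let $H^\infty$ be the space of bounded analytic functions in $\mathbb{D}$. The Bloch space $\mathcal{B}$ is the set of $f\in H(\mathbb{D})$ with $\sup_{z\in\mathbb{D}}(1-|z|^2)|f'(z)|<\infty$. For $1\le p<\infty$ and $0<r<1$ let $M_p(r,g)=\left(\frac1{2\pi}\int_0^{2\pi}|g(re^{i\theta})|^p\,d\theta\right)^{1/p}$. For $1\le p<\infty$ and $0<\alpha\le1$, the mean Lipschitz space $\Lambda^p_\alpha$ is the set of $f\in H(\mathbb{D})$ having non-tangential limits almost everywhere on the unit circle and such that the integral modulus of continuity of order $p$ of the boundary function $f(e^{i\theta})$ satisfies $\omega_p(t,f)=O(t^\alpha)$ as $t\to0$; by a well-known characterization, $\Lambda^p_\alpha$ consists exactly of those $f\in H(\mathbb{D})$ with $$\sup_{0<r<1}(1-r)^{1-\alpha}M_p(r,f')<\infty.$$ Here $\alpha=1/p$. A positive Borel measure $\mu$ on $[0,1)$ is an $s$-Carleson measure if there is a constant $C>0$ such that $\mu([t,1))\le C(1-t)^s$ for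 all $t\in[0,1)$. For a finite positive Borel measure $\mu$ on $[0,1)$ and an integer $n\ge0$, let $\mu_n=\int_{[0,1)}t^n\,d\mu(t)$. The operator $\mathcal{C}_{\mu,s}$ is defined on $f(z)=\sum_{n=0}^\infty a_nz^n\in H(\mathbb{D})$ by $$\mathcal{C}_{\mu,s}(f)(z)=\sum_{n=0}^\infty\left(\mu_n\sum_{k=0}^n\frac{\Gamma(n-k+s)}{\Gamma(s)(n-k)!}a_k\right)z^n,\qquad z\in\mathbb{D}.$$ *)

theory Defs
  imports "HOL-Complex_Analysis.Complex_Analysis" "HOL-Library.Function_Algebras"
    "HOL-Library.Landau_Symbols"
begin

text \<open>
  Analytic functions in the unit disc are represented by total functions \<open>complex \<Rightarrow> complex\<close>,
  whose values outside the disc are irrelevant. All the spaces below are closed under changing a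
  function outside the disc. A linear subspace \<open>X\<close> that contains one of them contains
  every function vanishing on the disc, so it is closed under such changes as well.
\<close>

definition H_disc :: "(complex \<Rightarrow> complex) set" where
  "H_disc = {f. f holomorphic_on ball 0 1}"

definition H_infinity :: "(complex \<Rightarrow> complex) set" where
  "H_infinity = {f \<in> H_disc. bounded (f ` ball 0 1)}"

definition bloch :: "(complex \<Rightarrow> complex) set" where
  "bloch = {f \<in> H_disc. bdd_above ((\<lambda>z. (1 - (norm z)\<^sup>2) * norm (deriv f z)) ` ball 0 1)}"

definition circle_norm :: "real \<Rightarrow> (complex \<Rightarrow> complex) \<Rightarrow> real" where
  "circle_norm p F =
     (1 / (2 * pi) * (LINT \<theta>:{0..2 * pi}|lebesgue. norm (F (cis \<theta>)) powr p)) powr (1 / p)"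

definition integral_mean :: "real \<Rightarrow> real \<Rightarrow> (complex \<Rightarrow> complex) \<Rightarrow> real" where
  "integral_mean p r g = circle_norm p (\<lambda>\<zeta>. g (of_real r * \<zeta>))"

definition hardy :: "real \<Rightarrow> (complex \<Rightarrow> complex) set" where
  "hardy p = {f \<in> H_disc. bdd_above ((\<lambda>r. integral_mean p r f) ` {0<..<1})}"

definition stolz_region :: "real \<Rightarrow> complex \<Rightarrow> complex set" where
  "stolz_region M \<zeta> = {z. norm z < 1 \<and> norm (z - \<zeta>) < M * (1 - norm z)}"

definition nontangential_limit :: "(complex \<Rightarrow> complex) \<Rightarrow> complex \<Rightarrow> complex \<Rightarrow> bool" where
  "nontangential_limit f \<zeta> L \<longleftrightarrow> (\<forall>M>1. (f \<longlongrightarrow> L) (at \<zeta> within stolz_region M \<zeta>))"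

definition boundary_fun :: "(complex \<Rightarrow> complex) \<Rightarrow> complex \<Rightarrow> complex" where
  "boundary_fun f \<zeta> = (THE L. nontangential_limit f \<zeta> L)"

definition integral_modulus :: "real \<Rightarrow> real \<Rightarrow> (complex \<Rightarrow> complex) \<Rightarrow> real" where
  "integral_modulus p t f =
     (SUP h\<in>{0<..t}. circle_norm p (\<lambda>\<zeta>. boundary_fun f (\<zeta> * cis h) - boundary_fun f \<zeta>))"

text \<open>
  Membership in the Hardy space is the standing convention behind the definition of the mean
  Lipschitz spaces and cannot be dropped: transported from the upper half-plane to the disc by
  a Cayley map, a nonzero entire function whose restriction to the real line is a Schwartz function
  with spectrum in a compact set of negative frequencies has a smooth boundary function but grows
  exponentially near one boundary point. Such a function satisfies neither the growth condition
  \<open>integral_mean p r (deriv f) = O((1 - r) powr (\<alpha> - 1))\<close>, which characterises the mean Lipschitz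
  space, nor the Bloch condition. For \<open>f\<close> in the Hardy space the boundary function lies in
  \<open>L\<^sup>p\<close> of the circle, so the Lebesgue integrals and the supremum in \<^const>\<open>integral_modulus\<close>
  are genuine.
\<close>

definition mean_lipschitz :: "real \<Rightarrow> real \<Rightarrow> (complex \<Rightarrow> complex) set" where
  "mean_lipschitz p \<alpha> =
     {f \<in> hardy p. (AE \<theta> in lebesgue. \<exists>L. nontangential_limit f (cis \<theta>) L) \<and>
        (\<lambda>t. integral_modulus p t f) \<in> O[at_right 0](\<lambda>t. t powr \<alpha>)}"

definition borel_measure_Ico01 :: "real measure \<Rightarrow> bool" where
  "borel_measure_Ico01 \<mu> \<longleftrightarrow> sets \<mu> = sets (restrict_space borel {0..<1})"

definition carleson_measure :: "real \<Rightarrow> real measure \<Rightarrow> bool" where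
  "carleson_measure s \<mu> \<longleftrightarrow> (\<exists>C>0. \<forall>t\<in>{0..<1}. measure \<mu> {t..<1} \<le> C * (1 - t) powr s)"

definition moment :: "real measure \<Rightarrow> nat \<Rightarrow> real" where
  "moment \<mu> n = (\<integral>t. t ^ n \<partial>\<mu>)"

definition taylor_coeff :: "(complex \<Rightarrow> complex) \<Rightarrow> nat \<Rightarrow> complex" where
  "taylor_coeff f n = (deriv ^^ n) f 0 / fact n"

definition cesaro_op :: "real measure \<Rightarrow> real \<Rightarrow> (complex \<Rightarrow> complex) \<Rightarrow> complex \<Rightarrow> complex" where
  "cesaro_op \<mu> s f z =
     (\<Sum>n. (of_real (moment \<mu> n) *
        (\<Sum>k\<le>n. of_real (Gamma (real (n - k) + s) / (Gamma s * fact (n - k))) * taylor_coeff f k))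
        * z ^ n)"

lemma module_complex_fun: "module (\<lambda>(c::complex) (f::complex \<Rightarrow> complex) z. c * f z)"
  by unfold_locales (auto simp: fun_eq_iff algebra_simps)

definition complex_subspace :: "(complex \<Rightarrow> complex) set \<Rightarrow> bool" where
  "complex_subspace X \<longleftrightarrow> module.subspace (\<lambda>c f z. c * f z) X"

end

theory Submission
  imports Defs
begin

text \<open>
  Put \<open>F(w) = f(w) (1 - w)\<^sup>-\<^sup>s\<close>. By the binomial series, \<open>cesaro_op \<mu> s f z = \<integral> F(tz) d\<mu>(t)\<close> in the disc.

  Necessity: for \<open>f = 1\<close> and \<open>y = (1 + x) / 2\<close> the Bloch condition bounds the increment of the
  image between \<open>x\<close> and \<open>y\<close> by a constant, while positivity of the integrand bounds it below by
  \<open>c (1 - x)\<^sup>-\<^sup>s \<mu>([x, 1))\<close>.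

  Sufficiency: for bounded \<open>f\<close> dominated convergence extends the integral continuously to
  \<open>|\<zeta>| = 1\<close>, \<open>\<zeta> \<noteq> 1\<close>, so neither Fatou's theorem nor the Hardy--Littlewood characterisation of
  the mean Lipschitz spaces is needed. A Cauchy estimate bounds \<open>|F(tz') - F(tz)|\<close> with
  \<open>|z' - z| \<le> h\<close> by a multiple of \<open>min(1, h/(1-t)) (|1-tz|\<^sup>-\<^sup>s + |1-tz'|\<^sup>-\<^sup>s)\<close>. Since
  \<open>|1-tz|\<close> dominates both \<open>1-t\<close> and \<open>|1-z|/2\<close>, the Carleson condition makes the integral of the
  \<open>z\<close> term \<open>O((h/|1-z|)\<^sup>\<sigma>)\<close> for every \<open>0 < \<sigma> < min(1, s)\<close>. As \<open>p > max(1, 1/s)\<close>, there are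
  admissible exponents on both sides of \<open>1/p\<close>; using the smaller one where \<open>|1-z| \<le> h\<close> and the
  larger one elsewhere gives an \<open>L\<^sup>p\<close> norm of order \<open>h\<close> to the power \<open>1/p\<close>.
\<close>

section \<open>Integral representation\<close>

definition cesaro_kernel :: "real \<Rightarrow> (complex \<Rightarrow> complex) \<Rightarrow> complex \<Rightarrow> complex" where
  "cesaro_kernel s f w = f w * (1 - w) powr (- of_real s)"

text \<open>The inner sum of \<open>cesaro_op\<close> without the moment factor. For analytic f and
  s > 0 these are the Taylor coefficients of \<open>cesaro_kernel s f\<close> at 0, by
  \<open>cesaro_kernel_sums\<close>.\<close>

definition cesaro_coeff :: "real \<Rightarrow> (complex \<Rightarrow> complex) \<Rightarrow> nat \<Rightarrow> complex" where
  "cesaro_coeff s f n =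
     (\<Sum>k\<le>n. of_real (Gamma (real (n - k) + s) / (Gamma s * fact (n - k))) * taylor_coeff f k)"

text \<open>The real part of 1 - w is positive, so the principal power in
  \<open>cesaro_kernel\<close> stays off its branch cut.\<close>

lemma one_minus_notin_nonpos_Reals: "norm (w::complex) < 1 \<Longrightarrow> 1 - w \<notin> \<real>\<^sub>\<le>\<^sub>0"
  using complex_Re_le_cmod[of w] by (auto simp: complex_nonpos_Reals_iff)

text \<open>The coefficient is \<open>pochhammer s n / fact n\<close>, which is (-1)^n times the
  generalized binomial coefficient of -s over n; the sign is absorbed by expanding at -w.\<close>

lemma binomial_series_Gamma:
  fixes s :: real and w :: complex
  assumes "0 < s" "norm w < 1"
  shows "(\<lambda>n. of_real (Gamma (real n + s) / (Gamma s * fact n)) * w ^ n)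
    sums (1 - w) powr (- of_real s)"
proof -
  have "pochhammer s n = Gamma (real n + s) / Gamma s" for n
    using assms by (subst pochhammer_Gamma) (auto simp: add.commute elim!: nonpos_Ints_cases)
  then have "of_real (Gamma (real n + s) / (Gamma s * fact n)) * w ^ n
      = (- of_real s gchoose n) * (- w) ^ n" for n
  proof -
    have "of_real (Gamma (real n + s) / (Gamma s * fact n)) = (of_real (pochhammer s n / fact n) :: complex)"
      using \<open>pochhammer s n = _\<close> by simp
    then show ?thesis
      by (simp add: gbinomial_pochhammer power_minus[of w] pochhammer_of_real mult_ac)
  qed
  with gen_binomial_complex[of "- w" "- of_real s"] assms show ?thesis
    by simp
qed

text \<open>Convergence at a real point rho with |w| < rho < 1 forces absolute convergence at w. The
  Cauchy product and the termwise integration below rely on it.\<close>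

lemma abs_summable_powser:
  fixes a :: "nat \<Rightarrow> complex"
  assumes "\<And>z. norm z < 1 \<Longrightarrow> summable (\<lambda>n. a n * z ^ n)" "norm w < 1"
  shows "summable (\<lambda>n. norm (a n * w ^ n))"
proof -
  obtain \<rho> where "norm w < \<rho>" "\<rho> < 1"
    using assms dense by blast
  then have "norm (of_real \<rho> :: complex) = \<rho>"
    using norm_ge_zero[of w] by (simp add: abs_of_nonneg order.trans[OF norm_ge_zero less_imp_le])
  then show ?thesis
    using assms(1)[of "of_real \<rho>"] \<open>norm w < \<rho>\<close> \<open>\<rho> < 1\<close> powser_insidea[of a "of_real \<rho>" w] by simp
qed

text \<open>Cauchy product of the Taylor series of f with the binomial series; the convolution of
  the coefficients is exactly the inner sum of the operator.\<close>

lemma cesaro_kernel_sums: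
  assumes "0 < s" "f \<in> H_disc" "norm w < 1"
  shows "(\<lambda>n. cesaro_coeff s f n * w ^ n) sums cesaro_kernel s f w"
proof -
  let ?c = "\<lambda>n. of_real (Gamma (real n + s) / (Gamma s * fact n)) :: complex"
  have f: "(\<lambda>n. taylor_coeff f n * z ^ n) sums f z" if "norm z < 1" for z
    using holomorphic_power_series[of f 0 1 z] assms(2) that
    by (simp add: H_disc_def taylor_coeff_def)
  have c: "(\<lambda>n. ?c n * z ^ n) sums (1 - z) powr (- of_real s)" if "norm z < 1" for z
    using binomial_series_Gamma assms that by blast
  have "(\<lambda>n. \<Sum>k\<le>n. (taylor_coeff f k * w ^ k) * (?c (n - k) * w ^ (n - k)))
      sums ((\<Sum>n. taylor_coeff f n * w ^ n) * (\<Sum>n. ?c n * w ^ n))"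
    using f c assms(3)
    by (intro Cauchy_product_sums abs_summable_powser) (auto simp: sums_iff)
  moreover have "(\<Sum>k\<le>n. (taylor_coeff f k * w ^ k) * (?c (n - k) * w ^ (n - k)))
      = cesaro_coeff s f n * w ^ n" for n
    unfolding cesaro_coeff_def sum_distrib_right
    by (intro sum.cong refl) (simp add: mult_ac flip: power_add)
  ultimately show ?thesis
    using sums_unique[OF f] sums_unique[OF c] assms(3) by (simp add: cesaro_kernel_def)
qed

lemma holomorphic_cesaro_kernel:
  assumes "f \<in> H_disc"
  shows "cesaro_kernel s f holomorphic_on ball 0 1"
proof -
  have "f holomorphic_on ball 0 1"
    using assms by (simp add: H_disc_def)
  then show ?thesis
    unfolding cesaro_kernel_def
    by (intro holomorphic_intros) (auto simp: one_minus_notin_nonpos_Reals)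
qed

lemma norm_cesaro_kernel: "norm (cesaro_kernel s f w) = norm (f w) * norm (1 - w) powr (- s)"
  by (simp add: cesaro_kernel_def norm_mult norm_powr_real_powr')

text \<open>As t < 1 strictly, z may lie on the unit circle: the kernel can be evaluated along rays
  that end at boundary points.\<close>

lemma norm_mult_of_real_less_1:
  "t \<in> {0..<1} \<Longrightarrow> norm z \<le> 1 \<Longrightarrow> norm (of_real t * (z::complex)) < 1"
  using mult_left_mono[of "norm z" 1 t] by (auto simp: norm_mult)

section \<open>Finite measures on [0,1) and the integral formula for the operator\<close>

locale finite_Ico01_measure = finite_measure \<mu> for \<mu> :: "real measure" +
  assumes borel: "borel_measure_Ico01 \<mu>"
begin

lemma sets_eq: "sets \<mu> = sets (restrict_space borel {0..<1})"
  using borel by (simp add: borel_measure_Ico01_def)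

lemma space_eq [simp]: "space \<mu> = {0..<1}"
  using sets_eq_imp_space_eq[OF sets_eq] by (simp add: space_restrict_space)

lemma borel_measurable_continuous:
  fixes g :: "real \<Rightarrow> 'b::topological_space"
  shows "continuous_on {0..<1} g \<Longrightarrow> g \<in> borel_measurable \<mu>"
  using borel_measurable_continuous_on_restrict measurable_cong_sets[OF sets_eq refl] by blast

lemma borel_measurable_borel [measurable (raw)]:
  "g \<in> borel_measurable borel \<Longrightarrow> g \<in> borel_measurable \<mu>"
  using measurable_restrict_space1[of g borel borel "{0..<1}"] measurable_cong_sets[OF sets_eq refl]
  by blast

lemma sets_Ico: "0 \<le> a \<Longrightarrow> {a..<1} \<in> sets \<mu>"
  by (auto simp: sets_eq sets_restrict_space_iff)

lemma integrable_bounded_continuous: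
  fixes g :: "real \<Rightarrow> 'b::{banach, second_countable_topology}"
  assumes "continuous_on {0..<1} g" "\<And>t. t \<in> {0..<1} \<Longrightarrow> norm (g t) \<le> B"
  shows "integrable \<mu> g"
  using assms by (intro integrable_const_bound[of _ B] borel_measurable_continuous) auto

text \<open>Kept apart from \<open>cesaro_op\<close> because the integral is also evaluated at
  boundary points other than 1, where it supplies the boundary values, while the power series is
  controlled only inside the disc.\<close>

definition cesaro_integral :: "real \<Rightarrow> (complex \<Rightarrow> complex) \<Rightarrow> complex \<Rightarrow> complex" where
  "cesaro_integral s f z = (\<integral>t. cesaro_kernel s f (of_real t * z) \<partial>\<mu>)"

lemma norm_mult_of_real_le: "t \<in> {0..<1} \<Longrightarrow> norm (of_real t * (z::complex)) \<le> norm z"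
  by (auto simp: norm_mult intro!: mult_left_le_one_le)

text \<open>Sum and integral may be exchanged: the n-th term is at most |c_n z^n| uniformly in t,
  these bounds are summable, and the total mass is finite. Integrating t^n then produces the
  moment.\<close>

lemma moment_cesaro_sums:
  assumes "0 < s" "f \<in> H_disc" "norm z < 1"
  shows "(\<lambda>n. of_real (moment \<mu> n) * cesaro_coeff s f n * z ^ n) sums cesaro_integral s f z"
proof -
  let ?g = "\<lambda>n t. cesaro_coeff s f n * (of_real t * z) ^ n"
  have sm: "summable (\<lambda>n. norm (cesaro_coeff s f n * z ^ n))"
    using cesaro_kernel_sums assms by (intro abs_summable_powser) (auto simp: sums_iff)
  have le: "norm (?g n t) \<le> norm (cesaro_coeff s f n * z ^ n)" if "t \<in> {0..<1}" for n t
    using norm_mult_of_real_le[OF that, of z]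
    by (auto simp: norm_mult norm_power simp del: of_real_power intro!: mult_left_mono power_mono)
  have int: "integrable \<mu> (?g n)" for n
    using le by (intro integrable_bounded_continuous continuous_intros)
  have "(\<lambda>n. integral\<^sup>L \<mu> (?g n)) sums (\<integral>t. (\<Sum>n. ?g n t) \<partial>\<mu>)"
  proof (rule sums_integral[OF int])
    show "AE t in \<mu>. summable (\<lambda>n. norm (?g n t))"
      using le by (intro AE_I2 summable_comparison_test'[OF sm]) auto
    have "(\<integral>t. norm (?g n t) \<partial>\<mu>) \<le> (\<integral>t. norm (cesaro_coeff s f n * z ^ n) \<partial>\<mu>)" for n
      using le by (intro integral_mono integrable_norm int) auto
    then show "summable (\<lambda>n. \<integral>t. norm (?g n t) \<partial>\<mu>)"
      by (intro summable_comparison_test'[OF summable_mult[OF sm, of "measure \<mu> (space \<mu>)"]]) auto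
  qed
  moreover have "(\<integral>t. (\<Sum>n. ?g n t) \<partial>\<mu>) = cesaro_integral s f z"
    unfolding cesaro_integral_def using assms norm_mult_of_real_less_1[of _ z]
    by (intro Bochner_Integration.integral_cong refl sums_unique[symmetric] cesaro_kernel_sums) auto
  moreover have "integral\<^sup>L \<mu> (?g n) = of_real (moment \<mu> n) * cesaro_coeff s f n * z ^ n" for n
  proof -
    have "integral\<^sup>L \<mu> (?g n) = (\<integral>t. (cesaro_coeff s f n * z ^ n) * of_real (t ^ n) \<partial>\<mu>)"
      by (intro Bochner_Integration.integral_cong) (auto simp: power_mult_distrib)
    also have "\<dots> = cesaro_coeff s f n * z ^ n * of_real (moment \<mu> n)"
      by (simp only: integral_mult_right_zero integral_complex_of_real moment_def)
    finally show ?thesis by (simp add: mult_ac)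
  qed
  ultimately show ?thesis by (simp only:)
qed

lemma cesaro_op_eq_integral:
  assumes "0 < s" "f \<in> H_disc" "norm z < 1"
  shows "cesaro_op \<mu> s f z = cesaro_integral s f z"
  using sums_unique[OF moment_cesaro_sums[OF assms]]
  by (simp add: cesaro_op_def cesaro_coeff_def)

lemma cesaro_op_H_disc:
  assumes "0 < s" "f \<in> H_disc"
  shows "cesaro_op \<mu> s f \<in> H_disc"
proof -
  have "cesaro_integral s f holomorphic_on ball 0 1"
    using moment_cesaro_sums[OF assms]
    by (intro power_series_holomorphic[of 0 1 "\<lambda>n. of_real (moment \<mu> n) * cesaro_coeff s f n"]) simp
  then show ?thesis
    unfolding H_disc_def
    by (auto elim!: holomorphic_transform simp: cesaro_op_eq_integral[OF assms])
qed

end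

section \<open>Carleson measures\<close>

context finite_Ico01_measure
begin

text \<open>On the radius [0,1) the image of the constant 1 is the real function \<open>G\<close>.
  Comparing the increment of \<open>G\<close> from x to the midpoint y of [x,1], bounded above by
  the Bloch condition, with the part of the integral over [x,1) yields the Carleson bound.\<close>

lemma carleson_if_bloch:
  assumes s: "0 < s" and bl: "cesaro_op \<mu> s (\<lambda>z. 1) \<in> bloch"
  shows "carleson_measure s \<mu>"
proof -
  let ?g = "cesaro_op \<mu> s (\<lambda>z. 1)"
  define G where "G x = (\<integral>t. (1 - t * x) powr (- s) \<partial>\<mu>)" for x
  \<comment> \<open>The constants come from the estimates below for t in [x,1) with x at least 1/2:
    1 - t y is at most 3/2 (1 - x), and 1 - t x is at least 7/6 (1 - t y).\<close>
  define c where "c = (3 / 2) powr (- s) * (1 - (7 / 6) powr (- s))"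
  have "(7 / 6 :: real) powr (- s) < 1"
    using s by (simp add: powr_less_one)
  then have c: "c > 0"
    by (simp add: c_def)
  have "(\<lambda>z. 1) \<in> H_disc"
    by (simp add: H_disc_def)
  have int: "integrable \<mu> (\<lambda>t. (1 - t * x) powr (- s))" if "0 \<le> x" "x < 1" for x
  proof (rule integrable_bounded_continuous)
    have le: "1 - t * x \<ge> 1 - x" if "t \<in> {0..<1}" for t
      using that \<open>0 \<le> x\<close> by (simp add: mult_left_le_one_le)
    then show "continuous_on {0..<1} (\<lambda>t. (1 - t * x) powr (- s))"
      using that by (intro continuous_intros) force
    show "norm ((1 - t * x) powr (- s)) \<le> (1 - x) powr (- s)" if "t \<in> {0..<1}" for t
      using le[OF that] s \<open>x < 1\<close> by (simp add: powr_mono2')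
  qed
  have g: "?g (of_real x) = of_real (G x)" if "0 \<le> x" "x < 1" for x
  proof -
    have "cesaro_kernel s (\<lambda>z. 1) (of_real t * of_real x) = of_real ((1 - t * x) powr (- s))"
      if "t \<in> {0..<1}" for t
    proof -
      have "1 - t * x \<ge> 0"
        using mult_mono[of t 1 x 1] that \<open>0 \<le> x\<close> \<open>x < 1\<close> by auto
      then have "of_real ((1 - t * x) powr (- s)) = (of_real (1 - t * x) :: complex) powr of_real (- s)"
        by (simp only: powr_of_real)
      then show ?thesis
        by (simp add: cesaro_kernel_def)
    qed
    then have "cesaro_integral s (\<lambda>z. 1) (of_real x)
        = (\<integral>t. complex_of_real ((1 - t * x) powr (- s)) \<partial>\<mu>)"
      unfolding cesaro_integral_def by (intro Bochner_Integration.integral_cong) auto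
    then show ?thesis
      using that cesaro_op_eq_integral[OF s \<open>(\<lambda>z. 1) \<in> H_disc\<close>, of "of_real x"]
      by (simp add: G_def)
  qed
  obtain K where K: "\<And>z. norm z < 1 \<Longrightarrow> (1 - (norm z)\<^sup>2) * norm (deriv ?g z) \<le> K"
    using bl by (force simp: bloch_def bdd_above_def)
  have hol: "?g holomorphic_on ball 0 1"
    using bl by (simp add: bloch_def H_disc_def)
  have half: "measure \<mu> {x..<1} \<le> K / c * (1 - x) powr s" if x: "1 / 2 \<le> x" "x < 1" for x
  proof -
    define y where "y = (1 + x) / 2"
    have y: "x < y" "y < 1" "0 < x"
      using x by (auto simp: y_def)
    have yx: "y - x = (1 - x) / 2"
      by (simp add: y_def field_simps)
    \<comment> \<open>Mean value estimate on the convex disc of radius y, where 1 - |z|^2 is at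
      least 1 - y. Because y is the midpoint, y - x = 1 - y, which cancels the denominator.\<close>
    have "norm (?g (of_real y) - ?g (of_real x)) \<le> K / (1 - y) * norm (of_real y - of_real x :: complex)"
    proof (rule field_differentiable_bound[where f' = "deriv ?g" and S = "cball 0 y"])
      fix z :: complex assume "z \<in> cball 0 y"
      then have z: "norm z \<le> y" "norm z < 1"
        using y by auto
      show "(?g has_field_derivative deriv ?g z) (at z within cball 0 y)"
        using hol z(2) by (intro holomorphic_derivI[of _ "ball 0 1"]) auto
      have "(norm z)\<^sup>2 \<le> norm z"
        using z by (simp add: power2_eq_square mult_left_le_one_le)
      then have "(1 - y) * norm (deriv ?g z) \<le> (1 - (norm z)\<^sup>2) * norm (deriv ?g z)"
        using z by (intro mult_right_mono) auto
      also have "\<dots> \<le> K"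
        using K z by blast
      finally show "norm (deriv ?g z) \<le> K / (1 - y)"
        using y by (simp add: field_simps)
    qed (use y in auto)
    moreover have "norm (of_real y - of_real x :: complex) = 1 - y"
    proof -
      have "norm (of_real y - of_real x :: complex) = y - x"
        using y by (simp flip: of_real_diff)
      then show ?thesis
        by (simp add: y_def field_simps)
    qed
    ultimately have "norm (of_real (G y) - of_real (G x) :: complex) \<le> K"
      using y by (simp add: g)
    then have GK: "G y - G x \<le> K"
      by (simp flip: of_real_diff)
    have "c * (1 - x) powr (- s) * measure \<mu> {x..<1} = (\<integral>t. c * (1 - x) powr (- s) * indicator {x..<1} t \<partial>\<mu>)"
      using sets_Ico[of x] y by simp
    also have "\<dots> \<le> (\<integral>t. (1 - t * y) powr (- s) - (1 - t * x) powr (- s) \<partial>\<mu>)"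
    proof (intro integral_mono Bochner_Integration.integrable_diff int)
      show "integrable \<mu> (\<lambda>t. c * (1 - x) powr (- s) * indicator {x..<1} t)"
        using sets_Ico[of x] y by (intro integrable_mult_right integrable_real_indicator) (auto simp: less_top[symmetric])
      fix t assume "t \<in> space \<mu>"
      then have t: "0 \<le> t" "t < 1" by auto
      have "t * x \<le> t * y"
        using t y by (intro mult_left_mono) auto
      moreover have ty: "t * y < 1"
      proof -
        have "t * y \<le> 1 * y"
          using t y by (intro mult_right_mono) auto
        then show ?thesis using y by linarith
      qed
      ultimately have mono: "(1 - t * x) powr (- s) \<le> (1 - t * y) powr (- s)"
        using s by (intro powr_mono2') auto
      \<comment> \<open>For t < x the left side vanishes and \<open>mono\<close> suffices. For t at
        least x, t is at least 1/2 and y - x = (1 - x)/2, so t y - t x is at least (1 - x)/4, hence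
        at least (1 - t y)/6 by \<open>up\<close>.\<close>
      show "c * (1 - x) powr (- s) * indicator {x..<1} t \<le> (1 - t * y) powr (- s) - (1 - t * x) powr (- s)"
      proof (cases "x \<le> t")
        case True
        have "t * y \<ge> x * y"
          using True y by (intro mult_right_mono) auto
        moreover have "x * y = 1 - 3 / 2 * (1 - x) + (1 - x) * (1 - x) / 2"
          by (simp add: y_def field_simps)
        moreover have "(1 - x) * (1 - x) \<ge> 0"
          by simp
        ultimately have up: "1 - t * y \<le> 3 / 2 * (1 - x)"
          by linarith
        have "(1 - x) / 4 = 1 / 2 * (y - x)"
          using yx by simp
        also have "\<dots> \<le> t * (y - x)"
          using True x y by (intro mult_right_mono) auto
        also have "\<dots> = t * y - t * x"
          by (rule right_diff_distrib)
        finally have "t * y - t * x \<ge> (1 - x) / 4" .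
        with up have "1 - t * x \<ge> 7 / 6 * (1 - t * y)"
          by argo
        then have "(1 - t * x) powr (- s) \<le> (7 / 6 * (1 - t * y)) powr (- s)"
          using s ty by (intro powr_mono2') auto
        also have "\<dots> = (7 / 6) powr (- s) * (1 - t * y) powr (- s)"
          by (rule powr_mult)
        finally have "(1 - t * y) powr (- s) - (1 - t * x) powr (- s)
            \<ge> (1 - t * y) powr (- s) * (1 - (7 / 6) powr (- s))"
          by (simp add: algebra_simps)
        moreover have "(1 - t * y) powr (- s) \<ge> (3 / 2 * (1 - x)) powr (- s)"
          using s ty up by (intro powr_mono2') auto
        then have "(1 - t * y) powr (- s) * (1 - (7 / 6) powr (- s))
            \<ge> (3 / 2 * (1 - x)) powr (- s) * (1 - (7 / 6) powr (- s))"
          using \<open>(7 / 6 :: real) powr (- s) < 1\<close> by (intro mult_right_mono) auto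
        moreover have "(3 / 2 * (1 - x)) powr (- s) * (1 - (7 / 6) powr (- s)) = c * (1 - x) powr (- s)"
          using x by (subst powr_mult) (auto simp: c_def)
        ultimately show ?thesis
          using True t by simp
      qed (use mono in auto)
    qed (use y in auto)
    also have "\<dots> = G y - G x"
      unfolding G_def using y by (intro Bochner_Integration.integral_diff int) auto
    finally have "c * (1 - x) powr (- s) * measure \<mu> {x..<1} \<le> K"
      using GK by simp
    then show ?thesis
      using c x by (simp add: powr_minus field_simps)
  qed
  \<comment> \<open>The entry 1 makes \<open>C\<close> positive. The last entry handles x < 1/2,
    where (2 (1 - x))^s exceeds 1 and the total mass is a sufficient bound.\<close>
  define C where "C = max 1 (max (K / c) (measure \<mu> (space \<mu>) * 2 powr s))"
  have "measure \<mu> {x..<1} \<le> C * (1 - x) powr s" if x: "x \<in> {0..<1}" for x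
  proof (cases "1 / 2 \<le> x")
    case True
    have "K / c * (1 - x) powr s \<le> C * (1 - x) powr s"
      by (intro mult_right_mono) (auto simp: C_def)
    with half[OF True] x show ?thesis by auto
  next
    case False
    have "1 \<le> (2 * (1 - x)) powr s"
      using False s by (intro ge_one_powr_ge_zero) auto
    also have "\<dots> = 2 powr s * (1 - x) powr s"
      by (rule powr_mult)
    finally have "measure \<mu> (space \<mu>) * 1 \<le> measure \<mu> (space \<mu>) * (2 powr s * (1 - x) powr s)"
      by (intro mult_left_mono) auto
    also have "\<dots> = measure \<mu> (space \<mu>) * 2 powr s * (1 - x) powr s"
      by simp
    also have "\<dots> \<le> C * (1 - x) powr s"
      by (intro mult_right_mono) (auto simp: C_def)
    finally show ?thesis
      using bounded_measure[of "{x..<1}"] by simp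
  qed
  moreover have "C > 0"
    by (simp add: C_def)
  ultimately show ?thesis
    by (auto simp: carleson_measure_def)
qed

text \<open>A dyadic band on which 1 - t is comparable to h w contributes a constant times
  h^\<sigma> min(1, 1/w) w^\<sigma>. Over the powers w of 2 this sums at 0 because \<sigma> > 0 and
  at infinity because \<sigma> < 1; \<sigma> < s makes the integrand monotone in 1 - t.\<close>

lemma carleson_measure_integral_bound:
  assumes "carleson_measure s \<mu>" "0 < \<sigma>" "\<sigma> < 1" "\<sigma> < s"
  obtains C where "0 < C"
    "\<And>h. 0 < h \<Longrightarrow> (\<integral>\<^sup>+t. ennreal (min 1 (h / (1 - t)) * (1 - t) powr (\<sigma> - s)) \<partial>\<mu>) \<le> ennreal (C * h powr \<sigma>)"
proof -
  obtain C0 where C0: "C0 > 0" "\<And>t. t \<in> {0..<1} \<Longrightarrow> measure \<mu> {t..<1} \<le> C0 * (1 - t) powr s"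
    using assms(1) by (auto simp: carleson_measure_def)
  \<comment> \<open>These are the points with 1 - t at most y; the truncation at 0 keeps the left
    endpoint in the range of the Carleson condition.\<close>
  define A where "A y = {max 0 (1 - y)..<1}" for y :: real
  have A: "A y \<in> sets \<mu>" for y
    by (simp add: A_def sets_Ico)
  have mA: "emeasure \<mu> (A y) \<le> ennreal (C0 * y powr s)" if "y > 0" for y
  proof -
    have "measure \<mu> (A y) \<le> C0 * (1 - max 0 (1 - y)) powr s"
      unfolding A_def using that by (intro C0) auto
    also have "\<dots> \<le> C0 * y powr s"
      using assms that C0 by (intro mult_left_mono powr_mono2) auto
    finally show ?thesis
      by (simp add: emeasure_eq_measure ennreal_leI)
  qed
  \<comment> \<open>Sum of the two geometric series that bound the bands below and above the scale
    h.\<close>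
  define S where "S = 1 / (1 - 2 powr (- \<sigma>)) + 1 / (1 - 2 powr (\<sigma> - 1))"
  have lt: "(2::real) powr (- \<sigma>) < 1" "(2::real) powr (\<sigma> - 1) < 1"
    using assms by (auto intro: powr_less_one)
  have S: "S > 0"
    unfolding S_def using lt by (intro add_pos_pos divide_pos_pos) auto
  \<comment> \<open>The dyadic scales indexed by the integers are split into negative exponents,
    \<open>u\<close>, and nonnegative ones, \<open>v\<close>; the shift by one in \<open>u\<close>
    keeps the exponent 0 from occurring twice.\<close>
  define u where "u k = 2 powr (- real (k + 1))" for k
  define v where "v k = 2 powr real k" for k
  show thesis
  proof
    show "C0 * 2 powr s * S > 0"
      using C0 S by simp
    fix h :: real assume h: "0 < h"
    define m where "m x = min 1 (h / x) * x powr (\<sigma> - s)" for x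
    have m0: "m x \<ge> 0" if "x > 0" for x
      using that h by (simp add: m_def)
    have m_antimono: "m x \<le> m y" if "0 < y" "y \<le> x" for x y
      unfolding m_def using that h assms
      by (intro mult_mono powr_mono2' min.mono divide_left_mono) auto
    let ?T = "\<lambda>y t. ennreal (m y) * indicator (A (2 * y)) t"
    \<comment> \<open>Writing the scale as h w separates the powers: the exponents \<sigma> - s from
      \<open>m\<close> and s from the Carleson bound add up to \<sigma>.\<close>
    have int_T: "(\<integral>\<^sup>+t. ?T (h * w) t \<partial>\<mu>) \<le> ennreal (C0 * 2 powr s * h powr \<sigma> * (min 1 (1 / w) * w powr \<sigma>))"
      if "w > 0" for w
    proof -
      have "(\<integral>\<^sup>+t. ?T (h * w) t \<partial>\<mu>) = ennreal (m (h * w)) * emeasure \<mu> (A (2 * (h * w)))"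
        using A by (intro nn_integral_cmult_indicator)
      also have "\<dots> \<le> ennreal (m (h * w)) * ennreal (C0 * (2 * (h * w)) powr s)"
        using h that by (intro mult_left_mono mA) auto
      also have "\<dots> = ennreal (m (h * w) * (C0 * (2 * (h * w)) powr s))"
        using h that C0 by (intro ennreal_mult[symmetric] m0) auto
      also have "m (h * w) * (C0 * (2 * (h * w)) powr s)
          = C0 * 2 powr s * h powr \<sigma> * (min 1 (1 / w) * w powr \<sigma>)"
      proof -
        have "h / (h * w) = 1 / w"
          using h by simp
        moreover have "(2 * (h * w)) powr s = 2 powr s * (h * w) powr s"
          by (rule powr_mult)
        moreover have "(h * w) powr (\<sigma> - s) * (h * w) powr s = h powr \<sigma> * w powr \<sigma>"
          using h that by (simp flip: powr_add powr_mult)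
        ultimately show ?thesis
          unfolding m_def by (simp add: mult_ac)
      qed
      finally show ?thesis .
    qed
    \<comment> \<open>\<open>m\<close> is antitone, so it is at most \<open>m y\<close> on \<open>y \<le> 1 - t \<le> 2 y\<close>; sum over the dyadic \<open>y = 2\<^sup>n h\<close>, \<open>n \<in> \<int>\<close>.\<close>
    have "(\<integral>\<^sup>+t. ennreal (m (1 - t)) \<partial>\<mu>) \<le> (\<integral>\<^sup>+t. (\<Sum>k. ?T (h * u k) t + ?T (h * v k) t) \<partial>\<mu>)"
    proof (rule nn_integral_mono)
      fix t assume "t \<in> space \<mu>"
      then have t: "0 \<le> t" "t < 1" by auto
      have le_T: "ennreal (m (1 - t)) \<le> ?T y t" if "0 < y" "y \<le> 1 - t" "1 - t \<le> 2 * y" for y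
        using that t m_antimono[of y "1 - t"] by (auto simp: A_def ennreal_leI)
      \<comment> \<open>This is the exponent whose scale h 2^n lies within a factor 2 below 1 -
        t.\<close>
      define n where "n = \<lfloor>log 2 ((1 - t) / h)\<rfloor>"
      have "2 powr n \<le> 2 powr log 2 ((1 - t) / h)" "2 powr log 2 ((1 - t) / h) \<le> 2 powr (n + 1)"
        unfolding n_def by (intro powr_mono, linarith, simp)+
      then have n: "h * 2 powr n \<le> 1 - t" "1 - t \<le> 2 * (h * 2 powr n)"
        using t h by (auto simp: powr_add field_simps)
      obtain k where "ennreal (m (1 - t)) \<le> ?T (h * u k) t + ?T (h * v k) t"
      proof (cases "n \<ge> 0")
        case True
        then have "v (nat n) = 2 powr n"
          by (simp add: v_def)
        with n h le_T[of "h * v (nat n)"] have "ennreal (m (1 - t)) \<le> ?T (h * v (nat n)) t"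
          by simp
        then have "ennreal (m (1 - t)) \<le> ?T (h * u (nat n)) t + ?T (h * v (nat n)) t"
          by (intro add_increasing) auto
        then show thesis by (rule that)
      next
        case False
        then have "- real (nat (- n - 1) + 1) = real_of_int n"
          by simp
        then have "u (nat (- n - 1)) = 2 powr n"
          by (simp only: u_def)
        with n h le_T[of "h * u (nat (- n - 1))"] have "ennreal (m (1 - t)) \<le> ?T (h * u (nat (- n - 1))) t"
          by simp
        then have "ennreal (m (1 - t)) \<le> ?T (h * u (nat (- n - 1))) t + ?T (h * v (nat (- n - 1))) t"
          by (intro add_increasing2) auto
        then show thesis by (rule that)
      qed
      also have "\<dots> \<le> (\<Sum>k. ?T (h * u k) t + ?T (h * v k) t)"
        using sum_le_suminf[of "\<lambda>k. ?T (h * u k) t + ?T (h * v k) t" "{k}"] by simp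
      finally show "ennreal (m (1 - t)) \<le> (\<Sum>k. ?T (h * u k) t + ?T (h * v k) t)" .
    qed
    also have "\<dots> = (\<Sum>k. (\<integral>\<^sup>+t. ?T (h * u k) t + ?T (h * v k) t \<partial>\<mu>))"
      using A by (intro nn_integral_suminf) simp
    also have "\<dots> \<le> (\<Sum>k. ennreal (C0 * 2 powr s * h powr \<sigma> * ((2 powr (- \<sigma>)) ^ k + (2 powr (\<sigma> - 1)) ^ k)))"
    proof (intro suminf_le summableI)
      fix k
      have "min 1 (1 / u k) * u k powr \<sigma> \<le> (2 powr (- \<sigma>)) ^ k"
      proof -
        have "u k \<le> 2 powr (- real k)"
          by (auto simp: u_def)
        then have "u k powr \<sigma> \<le> (2 powr (- real k)) powr \<sigma>"
          using assms by (intro powr_mono2) (auto simp: u_def)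
        also have "\<dots> = (2 powr (- \<sigma>)) ^ k"
          by (simp add: powr_powr flip: powr_realpow) (simp add: mult.commute)
        finally show ?thesis
          using mult_right_mono[of "min 1 (1 / u k)" 1 "u k powr \<sigma>"] by simp
      qed
      moreover have "min 1 (1 / v k) * v k powr \<sigma> \<le> (2 powr (\<sigma> - 1)) ^ k"
      proof -
        have "min 1 (1 / v k) * v k powr \<sigma> \<le> 1 / v k * v k powr \<sigma>"
          by (intro mult_right_mono) auto
        also have "\<dots> = (2 powr (\<sigma> - 1)) ^ k"
          by (simp add: v_def powr_powr powr_diff powr_minus field_simps flip: powr_realpow)
        finally show ?thesis .
      qed
      ultimately have "min 1 (1 / u k) * u k powr \<sigma> + min 1 (1 / v k) * v k powr \<sigma>
          \<le> (2 powr (- \<sigma>)) ^ k + (2 powr (\<sigma> - 1)) ^ k"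
        by (rule add_mono)
      then have le: "C0 * 2 powr s * h powr \<sigma> * (min 1 (1 / u k) * u k powr \<sigma> + min 1 (1 / v k) * v k powr \<sigma>)
          \<le> C0 * 2 powr s * h powr \<sigma> * ((2 powr (- \<sigma>)) ^ k + (2 powr (\<sigma> - 1)) ^ k)"
        using C0 by (intro mult_left_mono) auto
      have "(\<integral>\<^sup>+t. ?T (h * u k) t + ?T (h * v k) t \<partial>\<mu>) = (\<integral>\<^sup>+t. ?T (h * u k) t \<partial>\<mu>) + (\<integral>\<^sup>+t. ?T (h * v k) t \<partial>\<mu>)"
        using A by (intro nn_integral_add) auto
      also have "\<dots> \<le> ennreal (C0 * 2 powr s * h powr \<sigma> * (min 1 (1 / u k) * u k powr \<sigma>))
          + ennreal (C0 * 2 powr s * h powr \<sigma> * (min 1 (1 / v k) * v k powr \<sigma>))"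
        by (intro add_mono int_T) (auto simp: u_def v_def)
      also have "\<dots> = ennreal (C0 * 2 powr s * h powr \<sigma> * (min 1 (1 / u k) * u k powr \<sigma> + min 1 (1 / v k) * v k powr \<sigma>))"
        using C0 by (subst distrib_left, intro ennreal_plus[symmetric]) (auto simp: u_def v_def)
      finally show "(\<integral>\<^sup>+t. ?T (h * u k) t + ?T (h * v k) t \<partial>\<mu>)
          \<le> ennreal (C0 * 2 powr s * h powr \<sigma> * ((2 powr (- \<sigma>)) ^ k + (2 powr (\<sigma> - 1)) ^ k))"
        using le by (meson ennreal_leI order.trans)
    qed
    also have "\<dots> = ennreal (C0 * 2 powr s * h powr \<sigma> * S)"
      unfolding S_def using lt C0
      by (intro suminf_ennreal_eq sums_mult sums_add geometric_sums) auto
    finally show "(\<integral>\<^sup>+t. ennreal (min 1 (h / (1 - t)) * (1 - t) powr (\<sigma> - s)) \<partial>\<mu>)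
        \<le> ennreal (C0 * 2 powr s * S * h powr \<sigma>)"
      by (simp add: m_def mult_ac)
  qed
qed

end

section \<open>Estimates for the kernel\<close>

text \<open>Cauchy estimate on the circle about w of radius r, half the distance from w to the unit
  circle. Since 2 r is at most |1 - w|, every x on that circle satisfies |1 - x| >= |1 - w| /
  2.\<close>

lemma deriv_cesaro_kernel_bound:
  assumes s: "0 < s" and f: "f \<in> H_disc" and M: "\<And>z. norm z < 1 \<Longrightarrow> norm (f z) \<le> M"
    and w: "norm w < 1"
  shows "norm (deriv (cesaro_kernel s f) w) \<le> 2 * M * (norm (1 - w) / 2) powr (- s) / (1 - norm w)"
proof -
  define r where "r = (1 - norm w) / 2"
  have r: "r > 0" "norm w + r < 1"
    using w by (auto simp: r_def field_simps)
  have sub: "cball w r \<subseteq> ball 0 1"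
  proof
    fix x assume "x \<in> cball w r"
    then show "x \<in> ball 0 1"
      using r norm_triangle_ineq2[of x w] by (auto simp: dist_norm norm_minus_commute)
  qed
  have "1 - norm w \<le> norm (1 - w)"
    using norm_triangle_ineq2[of 1 w] by simp
  have "norm ((deriv ^^ 1) (cesaro_kernel s f) w) \<le> fact 1 * (M * (norm (1 - w) / 2) powr (- s)) / r ^ 1"
  proof (rule Cauchy_inequality)
    have "cesaro_kernel s f holomorphic_on cball w r"
      using holomorphic_cesaro_kernel[OF f] sub by (rule holomorphic_on_subset)
    then show "cesaro_kernel s f holomorphic_on ball w r" "continuous_on (cball w r) (cesaro_kernel s f)"
      by (auto intro: holomorphic_on_subset holomorphic_on_imp_continuous_on)
    fix x assume x: "norm (w - x) = r"
    then have "norm x < 1"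
      using sub by (auto simp: dist_norm)
    have "norm (1 - w) \<le> norm (1 - x) + norm (x - w)"
      using norm_triangle_ineq[of "1 - x" "x - w"] by simp
    then have "norm (1 - w) / 2 \<le> norm (1 - x)"
      using x \<open>1 - norm w \<le> norm (1 - w)\<close> by (simp add: r_def norm_minus_commute field_simps)
    then have "norm (1 - x) powr (- s) \<le> (norm (1 - w) / 2) powr (- s)"
      using s w by (intro powr_mono2') auto
    then show "norm (cesaro_kernel s f x) \<le> M * (norm (1 - w) / 2) powr (- s)"
      unfolding norm_cesaro_kernel using M[OF \<open>norm x < 1\<close>] order.trans[OF norm_ge_zero M[OF w]]
      by (intro mult_mono) auto
  qed (use r in auto)
  then show ?thesis
    by (simp add: r_def mult_ac)
qed

lemma one_minus_le_norm:
  assumes "t \<in> {0..<1}" "norm z \<le> 1"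
  shows "1 - t \<le> norm (1 - of_real t * (z :: complex))"
proof -
  have "norm (of_real t * z) \<le> t"
    using assms mult_left_mono[of "norm z" 1 t] by (auto simp: norm_mult)
  then show ?thesis
    using norm_triangle_ineq2[of 1 "of_real t * z"] by simp
qed

text \<open>From |1 - z| <= |1 - t z| + (1 - t) |z|, where the last term is at most 1 - t and hence
  at most |1 - t z|.\<close>

lemma norm_one_minus_mult_ge:
  assumes "t \<in> {0..1}" "norm z \<le> 1"
  shows "norm (1 - z) / 2 \<le> norm (1 - of_real t * (z :: complex))"
proof -
  have "norm (of_real t * z) \<le> t"
    using assms mult_left_mono[of "norm z" 1 t] by (auto simp: norm_mult)
  then have "1 - t \<le> norm (1 - of_real t * z)"
    using norm_triangle_ineq2[of 1 "of_real t * z"] by simp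
  moreover have "norm (of_real t * z - z) = (1 - t) * norm z"
  proof -
    have "of_real t * z - z = - (of_real (1 - t) * z)"
      by (simp add: algebra_simps)
    then have "norm (of_real t * z - z) = \<bar>1 - t\<bar> * norm z"
      by (simp only: norm_minus_cancel norm_mult norm_of_real)
    then show ?thesis
      using assms by simp
  qed
  moreover have "(1 - t) * norm z \<le> 1 - t"
    using assms mult_left_mono[of "norm z" 1 "1 - t"] by simp
  moreover have "norm (1 - z) \<le> norm (1 - of_real t * z) + norm (of_real t * z - z)"
    using norm_triangle_ineq[of "1 - of_real t * z" "of_real t * z - z"] by simp
  ultimately show ?thesis
    by simp
qed

text \<open>If h > 1 - t, the triangle inequality is enough. Otherwise the derivative is bounded
  along the segment from t z to t z', where the distance to 1 stays comparable to |1 - t z|.\<close>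

lemma cesaro_kernel_diff_bound:
  assumes s: "0 < s" and f: "f \<in> H_disc" and M: "\<And>z. norm z < 1 \<Longrightarrow> norm (f z) \<le> M"
    and t: "t \<in> {0..<1}" and z: "norm z \<le> 1" "norm z' \<le> 1" and h: "norm (z' - z) \<le> h"
  shows "norm (cesaro_kernel s f (of_real t * z') - cesaro_kernel s f (of_real t * z))
    \<le> 2 * M * 4 powr s * (min 1 (h / (1 - t)) *
        norm (1 - of_real t * z) powr (- s) + min 1 (h / (1 - t)) * norm (1 - of_real t * z') powr (- s))"
    (is "?L \<le> 2 * M * 4 powr s * (?m * ?a + ?m * ?b)")
proof -
  have M0: "M \<ge> 0"
    using order.trans[OF norm_ge_zero M[of 0]] by simp
  have h0: "h \<ge> 0"
    using order.trans[OF norm_ge_zero h] .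
  have m0: "?m \<ge> 0"
    using h0 t by simp
  have four: "4 powr s \<ge> 1"
    using s by (intro ge_one_powr_ge_zero) auto
  show ?thesis
  proof (cases "h \<le> 1 - t")
    case False
    then have "?m = 1"
      using t by auto
    have "?L \<le> norm (cesaro_kernel s f (of_real t * z')) + norm (cesaro_kernel s f (of_real t * z))"
      by (rule norm_triangle_ineq4)
    also have "\<dots> \<le> M * ?b + M * ?a"
      unfolding norm_cesaro_kernel using t z
      by (intro add_mono mult_right_mono M norm_mult_of_real_less_1) auto
    also have "\<dots> = M * 1 * (?a + ?b)"
      by (simp add: algebra_simps)
    also have "\<dots> \<le> (2 * M) * 4 powr s * (?a + ?b)"
      using four M0 by (intro mult_right_mono mult_mono) auto
    finally show ?thesis
      by (simp add: \<open>?m = 1\<close>)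
  next
    case True
    then have m: "?m = h / (1 - t)"
      using t by (auto simp: field_simps)
    have dist: "norm (of_real t * z' - of_real t * z) \<le> h"
    proof -
      have "norm (of_real t * z' - of_real t * z) = t * norm (z' - z)"
        using t by (simp add: norm_mult flip: right_diff_distrib)
      also have "\<dots> \<le> 1 * h"
        using t h by (intro mult_mono) auto
      finally show ?thesis by simp
    qed
    let ?S = "closed_segment (of_real t * z) (of_real t * z')"
    have "?L \<le> 2 * M * (4 powr s * ?a) / (1 - t) * norm (of_real t * z' - of_real t * z)"
    proof (rule field_differentiable_bound[where f' = "deriv (cesaro_kernel s f)" and S = ?S])
      fix w assume w: "w \<in> ?S"
      have "norm (of_real t * z) \<le> t" "norm (of_real t * z') \<le> t"
        using t z mult_left_mono[of _ 1 t] by (auto simp: norm_mult)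
      then have "?S \<subseteq> cball 0 t"
        by (intro closed_segment_subset) auto
      with w have wt: "norm w \<le> t"
        by auto
      then have w1: "norm w < 1"
        using t by auto
      then show "(cesaro_kernel s f has_field_derivative deriv (cesaro_kernel s f) w) (at w within ?S)"
        using holomorphic_cesaro_kernel[OF f] by (intro holomorphic_derivI[of _ "ball 0 1"]) auto
      have "norm (w - of_real t * z) \<le> h"
        using segment_bound1[OF w] dist by simp
      then have "norm (1 - of_real t * z) \<le> norm (1 - w) + h"
        using norm_triangle_ineq[of "1 - w" "w - of_real t * z"] by simp
      moreover have "h \<le> norm (1 - w)"
        using True wt norm_triangle_ineq2[of 1 w] by simp
      \<comment> \<open>Here |1 - t z| <= |1 - w| + h <= 2 |1 - w|. The further halving in the
        Cauchy estimate turns the 2 into 4, the source of the constant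
        \<open>4 powr s\<close>.\<close>
      ultimately have "norm (1 - of_real t * z) / 4 \<le> norm (1 - w) / 2"
        by simp
      moreover have "0 < norm (1 - of_real t * z)"
        using one_minus_le_norm[OF t z(1)] t by auto
      ultimately have "(norm (1 - w) / 2) powr (- s) \<le> (norm (1 - of_real t * z) / 4) powr (- s)"
        using s by (intro powr_mono2') auto
      also have "\<dots> = 4 powr s * ?a"
        by (simp add: powr_divide powr_minus field_simps)
      finally have "2 * M * (norm (1 - w) / 2) powr (- s) / (1 - norm w) \<le> 2 * M * (4 powr s * ?a) / (1 - t)"
        using M0 wt t by (intro frac_le mult_left_mono mult_nonneg_nonneg) auto
      then show "norm (deriv (cesaro_kernel s f) w) \<le> 2 * M * (4 powr s * ?a) / (1 - t)"
        using deriv_cesaro_kernel_bound[OF s f M w1] by linarith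
    qed auto
    also have "\<dots> \<le> 2 * M * (4 powr s * ?a) / (1 - t) * h"
      using dist M0 t by (intro mult_left_mono) auto
    also have "\<dots> = 2 * M * 4 powr s * (?m * ?a)"
      using m by simp
    also have "\<dots> \<le> 2 * M * 4 powr s * (?m * ?a + ?m * ?b)"
      using M0 m0 by (intro mult_left_mono) auto
    finally show ?thesis .
  qed
qed

text \<open>For a <= b this is q^a when q >= 1 and q^b when q <= 1. With q = h / |1 - z| it selects
  the smaller exponent where |1 - z| <= h and the larger one elsewhere.\<close>

definition min_powr :: "real \<Rightarrow> real \<Rightarrow> real \<Rightarrow> real" where
  "min_powr a b q = min (q powr a) (q powr b)"

lemma min_powr_nonneg [simp]: "0 \<le> min_powr a b q"
  by (simp add: min_powr_def)

lemma min_powr_mono: "0 \<le> a \<Longrightarrow> 0 \<le> b \<Longrightarrow> 0 \<le> q \<Longrightarrow> q \<le> q' \<Longrightarrow> min_powr a b q \<le> min_powr a b q'"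
  unfolding min_powr_def by (intro min.mono powr_mono2)

lemma min_powr_powr: "0 \<le> p \<Longrightarrow> min_powr a b q powr p = min_powr (a * p) (b * p) q"
  by (auto simp: min_powr_def min_def powr_powr dest: powr_mono2[of p, rotated 2])
     (smt (verit) powr_ge_zero powr_mono2 powr_powr)+

lemma borel_measurable_min_powr [measurable]: "min_powr a b \<in> borel_measurable borel"
  unfolding min_powr_def[abs_def] by measurable

section \<open>Boundary limits of the integral and its increments under the Carleson
  condition\<close>

context finite_Ico01_measure
begin

lemma continuous_on_cesaro_kernel_ray:
  assumes "f \<in> H_disc" "norm z \<le> 1"
  shows "continuous_on {0..<1} (\<lambda>t. cesaro_kernel s f (of_real t * z))"
proof -
  have "continuous_on (ball 0 1) (cesaro_kernel s f)"
    using holomorphic_cesaro_kernel[OF assms(1)] by (rule holomorphic_on_imp_continuous_on)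
  moreover have "(\<lambda>t. of_real t * z) ` {0..<1} \<subseteq> ball 0 1"
    using norm_mult_of_real_less_1[OF _ assms(2)] by (intro image_subsetI) (simp only: mem_ball_0)
  ultimately show ?thesis
    by (intro continuous_on_compose2[of "ball 0 1" "cesaro_kernel s f" _ "\<lambda>t. of_real t * z"]
        continuous_intros)
qed

text \<open>The bound is uniform in t and in all z at distance at least d from 1, so it serves as a
  constant dominating function.\<close>

lemma norm_cesaro_kernel_ray_le:
  assumes "0 < s" "\<And>z. norm z < 1 \<Longrightarrow> norm (f z) \<le> M"
    and "t \<in> {0..<1}" "norm z \<le> 1" "0 < d" "d \<le> norm (1 - z)"
  shows "norm (cesaro_kernel s f (of_real t * z)) \<le> M * (d / 2) powr (- s)"
  unfolding norm_cesaro_kernel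
  using assms norm_mult_of_real_less_1[of t z] norm_one_minus_mult_ge[of t z]
    order.trans[OF norm_ge_zero assms(2)[of 0]]
  by (intro mult_mono powr_mono2') auto

lemma integrable_cesaro_kernel:
  assumes "0 < s" "f \<in> H_disc" "\<And>z. norm z < 1 \<Longrightarrow> norm (f z) \<le> M" "norm z \<le> 1" "z \<noteq> 1"
  shows "integrable \<mu> (\<lambda>t. cesaro_kernel s f (of_real t * z))"
  using assms
  by (intro integrable_bounded_continuous[where B = "M * (norm (1 - z) / 2) powr (- s)"]
      continuous_on_cesaro_kernel_ray norm_cesaro_kernel_ray_le) auto

text \<open>Near a boundary point other than 1 the kernels along rays share one constant bound, so
  dominated convergence gives a limit through the whole disc, not merely through Stolz
  regions.\<close>

lemma tendsto_cesaro_integral: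
  assumes s: "0 < s" and f: "f \<in> H_disc" and M: "\<And>z. norm z < 1 \<Longrightarrow> norm (f z) \<le> M"
    and \<zeta>: "norm \<zeta> = 1" "\<zeta> \<noteq> 1"
  shows "(cesaro_integral s f \<longlongrightarrow> cesaro_integral s f \<zeta>) (at \<zeta> within ball 0 1)"
proof -
  define d where "d = norm (1 - \<zeta>) / 2"
  have d: "d > 0"
    using \<zeta> by (simp add: d_def)
  have "norm (1 - z) \<ge> d" if "z \<in> ball \<zeta> d" for z
  proof -
    have "norm (1 - \<zeta>) \<le> norm (1 - z) + norm (z - \<zeta>)"
      using norm_triangle_ineq[of "1 - z" "z - \<zeta>"] by simp
    then show ?thesis
      using that by (simp add: d_def dist_norm norm_minus_commute)
  qed
  \<comment> \<open>Passing to the points at distance at least d from 1 leaves the filter unchanged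
    and makes the dominating constant available; sequences then bring the claim into the form of
    dominated convergence.\<close>
  then have "at \<zeta> within ball 0 1 = at \<zeta> within (ball 0 1 \<inter> {z. d \<le> norm (1 - z)})"
    using d by (intro at_within_nhd[of \<zeta> "ball \<zeta> d"]) auto
  moreover have "(cesaro_integral s f \<longlongrightarrow> cesaro_integral s f \<zeta>)
      (at \<zeta> within (ball 0 1 \<inter> {z. d \<le> norm (1 - z)}))"
    unfolding tendsto_at_iff_sequentially comp_def
  proof (intro allI impI)
    fix X assume "\<forall>i. X i \<in> ball 0 1 \<inter> {z. d \<le> norm (1 - z)} - {\<zeta>}" and lim: "X \<longlonglongrightarrow> \<zeta>"
    then have X: "norm (X i) < 1" "d \<le> norm (1 - X i)" for i
      by auto
    show "(\<lambda>i. cesaro_integral s f (X i)) \<longlonglongrightarrow> cesaro_integral s f \<zeta>"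
      unfolding cesaro_integral_def
    proof (rule integral_dominated_convergence)
      show "integrable \<mu> (\<lambda>t. M * (d / 2) powr (- s))"
        by simp
      show "AE t in \<mu>. (\<lambda>i. cesaro_kernel s f (of_real t * X i)) \<longlonglongrightarrow> cesaro_kernel s f (of_real t * \<zeta>)"
      proof (rule AE_I2)
        fix t assume "t \<in> space \<mu>"
        then have "of_real t * \<zeta> \<in> ball 0 1"
          using \<zeta> norm_mult_of_real_less_1[of t \<zeta>] by simp
        then have "isCont (cesaro_kernel s f) (of_real t * \<zeta>)"
          using holomorphic_on_imp_continuous_on[OF holomorphic_cesaro_kernel[OF f]]
          by (simp add: continuous_on_eq_continuous_at)
        then show "(\<lambda>i. cesaro_kernel s f (of_real t * X i)) \<longlonglongrightarrow> cesaro_kernel s f (of_real t * \<zeta>)"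
          using lim by (intro isCont_tendsto_compose[of _ "cesaro_kernel s f"] tendsto_intros)
      qed
      show "AE t in \<mu>. norm (cesaro_kernel s f (of_real t * X i)) \<le> M * (d / 2) powr (- s)" for i
        using s M X[of i] d by (intro AE_I2 norm_cesaro_kernel_ray_le) auto
      show "(\<lambda>t. cesaro_kernel s f (of_real t * \<zeta>)) \<in> borel_measurable \<mu>"
        using f \<zeta> by (intro borel_measurable_continuous continuous_on_cesaro_kernel_ray) auto
      show "(\<lambda>t. cesaro_kernel s f (of_real t * X i)) \<in> borel_measurable \<mu>" for i
        using f X[of i] by (intro borel_measurable_continuous continuous_on_cesaro_kernel_ray) auto
    qed
  qed
  ultimately show ?thesis by simp
qed

text \<open>Split the exponent -s into -\<sigma> and \<sigma> - s, and bound |1 - t z| below by d/2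
  in the first factor and by 1 - t in the second. The parameter d is free so that it can be |1 - z|
  for increments and |1 - \<zeta>| for points z = r \<zeta>.\<close>

lemma nn_integral_kernel_bound:
  assumes "carleson_measure s \<mu>" "0 < \<sigma>" "\<sigma> < 1" "\<sigma> < s"
  obtains C where "0 < C"
    "\<And>h d z. \<lbrakk>0 < h; 0 < d; norm z \<le> 1; \<And>t. t \<in> {0..<1} \<Longrightarrow> d / 2 \<le> norm (1 - of_real t * (z :: complex))\<rbrakk> \<Longrightarrow>
      (\<integral>\<^sup>+t. ennreal (min 1 (h / (1 - t)) * norm (1 - of_real t * z) powr (- s)) \<partial>\<mu>)
        \<le> ennreal (C * (h / d) powr \<sigma>)"
proof -
  obtain C where C: "0 < C" "\<And>h. 0 < h \<Longrightarrow>
      (\<integral>\<^sup>+t. ennreal (min 1 (h / (1 - t)) * (1 - t) powr (\<sigma> - s)) \<partial>\<mu>) \<le> ennreal (C * h powr \<sigma>)"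
    using carleson_measure_integral_bound[OF assms] by blast
  show thesis
  proof
    show "0 < C * 2 powr \<sigma>"
      using C by simp
    fix h d :: real and z :: complex
    assume h: "0 < h" "0 < d" and z: "norm z \<le> 1"
      and d: "\<And>t. t \<in> {0..<1} \<Longrightarrow> d / 2 \<le> norm (1 - of_real t * z)"
    let ?m = "\<lambda>t. min 1 (h / (1 - t)) * (1 - t) powr (\<sigma> - s)"
    have "(\<integral>\<^sup>+t. ennreal (min 1 (h / (1 - t)) * norm (1 - of_real t * z) powr (- s)) \<partial>\<mu>)
        \<le> (\<integral>\<^sup>+t. ennreal ((d / 2) powr (- \<sigma>)) * ennreal (?m t) \<partial>\<mu>)"
    proof (rule nn_integral_mono)
      fix t assume "t \<in> space \<mu>"
      then have t: "t \<in> {0..<1}" by simp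
      have "norm (1 - of_real t * z) powr (- s)
          = norm (1 - of_real t * z) powr (- \<sigma>) * norm (1 - of_real t * z) powr (\<sigma> - s)"
        by (simp flip: powr_add)
      also have "\<dots> \<le> (d / 2) powr (- \<sigma>) * (1 - t) powr (\<sigma> - s)"
        using t z d[OF t] h assms by (intro mult_mono powr_mono2' one_minus_le_norm) auto
      finally have "min 1 (h / (1 - t)) * norm (1 - of_real t * z) powr (- s)
          \<le> min 1 (h / (1 - t)) * ((d / 2) powr (- \<sigma>) * (1 - t) powr (\<sigma> - s))"
        using h t by (intro mult_left_mono) auto
      also have "\<dots> = (d / 2) powr (- \<sigma>) * ?m t"
        by simp
      finally show "ennreal (min 1 (h / (1 - t)) * norm (1 - of_real t * z) powr (- s))
          \<le> ennreal ((d / 2) powr (- \<sigma>)) * ennreal (?m t)"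
        by (subst ennreal_mult[symmetric]) (use h t in \<open>auto intro: ennreal_leI\<close>)
    qed
    also have "\<dots> = ennreal ((d / 2) powr (- \<sigma>)) * (\<integral>\<^sup>+t. ennreal (?m t) \<partial>\<mu>)"
      by (intro nn_integral_cmult) measurable
    also have "\<dots> \<le> ennreal ((d / 2) powr (- \<sigma>)) * ennreal (C * h powr \<sigma>)"
      using h by (intro mult_left_mono C) auto
    also have "\<dots> = ennreal ((d / 2) powr (- \<sigma>) * (C * h powr \<sigma>))"
      using C by (intro ennreal_mult[symmetric]) auto
    also have "(d / 2) powr (- \<sigma>) * (C * h powr \<sigma>) = C * 2 powr \<sigma> * (h / d) powr \<sigma>"
      by (simp add: powr_divide powr_minus field_simps)
    finally show "(\<integral>\<^sup>+t. ennreal (min 1 (h / (1 - t)) * norm (1 - of_real t * z) powr (- s)) \<partial>\<mu>)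
        \<le> ennreal (C * 2 powr \<sigma> * (h / d) powr \<sigma>)" .
  qed
qed

lemma nn_integral_kernel_bound_min:
  assumes "carleson_measure s \<mu>" "0 < \<sigma>" "\<sigma> < \<tau>" "\<tau> < 1" "\<tau> < s"
  obtains C where "0 < C"
    "\<And>h d z. \<lbrakk>0 < h; 0 < d; norm z \<le> 1; \<And>t. t \<in> {0..<1} \<Longrightarrow> d / 2 \<le> norm (1 - of_real t * (z :: complex))\<rbrakk> \<Longrightarrow>
      (\<integral>\<^sup>+t. ennreal (min 1 (h / (1 - t)) * norm (1 - of_real t * z) powr (- s)) \<partial>\<mu>)
        \<le> ennreal (C * min_powr \<sigma> \<tau> (h / d))"
proof -
  let ?I = "\<lambda>h z. \<integral>\<^sup>+t. ennreal (min 1 (h / (1 - t)) * norm (1 - of_real t * (z :: complex)) powr (- s)) \<partial>\<mu>"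
  obtain C1 where C1: "0 < C1"
    "\<And>h d z. \<lbrakk>0 < h; 0 < d; norm z \<le> 1; \<And>t. t \<in> {0..<1} \<Longrightarrow> d / 2 \<le> norm (1 - of_real t * (z :: complex))\<rbrakk> \<Longrightarrow>
      ?I h z \<le> ennreal (C1 * (h / d) powr \<sigma>)"
    using nn_integral_kernel_bound[of s \<sigma>] assms by (auto simp del: atLeastLessThan_iff)
  obtain C2 where C2: "0 < C2"
    "\<And>h d z. \<lbrakk>0 < h; 0 < d; norm z \<le> 1; \<And>t. t \<in> {0..<1} \<Longrightarrow> d / 2 \<le> norm (1 - of_real t * (z :: complex))\<rbrakk> \<Longrightarrow>
      ?I h z \<le> ennreal (C2 * (h / d) powr \<tau>)"
    using nn_integral_kernel_bound[of s \<tau>] assms by (auto simp del: atLeastLessThan_iff)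
  show thesis
  proof (rule that)
    show "0 < max C1 C2"
      using C1 by simp
    fix h d :: real and z :: complex
    assume *: "0 < h" "0 < d" "norm z \<le> 1" "\<And>t. t \<in> {0..<1} \<Longrightarrow> d / 2 \<le> norm (1 - of_real t * z)"
    have "?I h z \<le> ennreal (max C1 C2 * (h / d) powr \<sigma>)"
      using C1(2)[OF *] by (rule order.trans) (auto intro!: ennreal_leI mult_right_mono)
    moreover have "?I h z \<le> ennreal (max C1 C2 * (h / d) powr \<tau>)"
      using C2(2)[OF *] by (rule order.trans) (auto intro!: ennreal_leI mult_right_mono)
    ultimately show "?I h z \<le> ennreal (max C1 C2 * min_powr \<sigma> \<tau> (h / d))"
      by (simp add: min_powr_def min_def)
  qed
qed

text \<open>The first estimate controls increments, the second growth along circles uniformly in the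
  radius. They are integrated later for the modulus of continuity and for the Hardy norm
  respectively.\<close>

lemma cesaro_integral_bounds:
  assumes carl: "carleson_measure s \<mu>" and st: "0 < \<sigma>" "\<sigma> < \<tau>" "\<tau> < 1" "\<tau> < s"
    and f: "f \<in> H_disc" and M: "\<And>z. norm z < 1 \<Longrightarrow> norm (f z) \<le> M"
  obtains C where "0 < C"
    "\<And>h z z'. \<lbrakk>0 < h; norm z \<le> 1; norm z' \<le> 1; z \<noteq> 1; z' \<noteq> 1; norm (z' - z) \<le> h\<rbrakk> \<Longrightarrow>
      norm (cesaro_integral s f z' - cesaro_integral s f z)
        \<le> C * (min_powr \<sigma> \<tau> (h / norm (1 - z)) + min_powr \<sigma> \<tau> (h / norm (1 - z')))"
    "\<And>r \<zeta>. \<lbrakk>0 \<le> r; r < 1; norm \<zeta> = 1; \<zeta> \<noteq> 1\<rbrakk> \<Longrightarrow>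
      norm (cesaro_integral s f (of_real r * \<zeta>)) \<le> C * min_powr \<sigma> \<tau> (1 / norm (1 - \<zeta>))"
proof -
  let ?G = "min_powr \<sigma> \<tau>"
  let ?k = "\<lambda>h z t. min 1 (h / (1 - t)) * norm (1 - of_real t * (z :: complex)) powr (- s)"
  obtain C where C: "0 < C"
    "\<And>h d z. \<lbrakk>0 < h; 0 < d; norm z \<le> 1; \<And>t. t \<in> {0..<1} \<Longrightarrow> d / 2 \<le> norm (1 - of_real t * (z :: complex))\<rbrakk> \<Longrightarrow>
      (\<integral>\<^sup>+t. ennreal (?k h z t) \<partial>\<mu>) \<le> ennreal (C * ?G (h / d))"
    using nn_integral_kernel_bound_min[OF carl st] by blast
  have s: "0 < s"
    using st by simp
  have M0: "M \<ge> 0"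
    using order.trans[OF norm_ge_zero M[of 0]] by simp
  define L where "L = 2 * M * 4 powr s"
  have M_le_L: "M \<le> L"
    using M0 s mult_mono[of M "2 * M" 1 "4 powr s"] ge_one_powr_ge_zero[of 4 s] by (simp add: L_def)
  have L0: "L \<ge> 0"
    using M0 by (simp add: L_def)
  show thesis
  proof (rule that)
    \<comment> \<open>\<open>L + 1\<close> in place of \<open>L\<close> keeps the constant positive
      when M = 0.\<close>
    show "0 < (L + 1) * C"
      using C L0 by simp
  next
    fix h z z' assume h: "0 < (h :: real)" and z: "norm z \<le> 1" "norm z' \<le> 1" "z \<noteq> (1::complex)" "z' \<noteq> 1"
      and d: "norm (z' - z) \<le> h"
    let ?F = "\<lambda>z t. cesaro_kernel s f (of_real t * z)"
    have int: "integrable \<mu> (?F z)" "integrable \<mu> (?F z')"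
      using s f M z by (auto intro!: integrable_cesaro_kernel)
    have meas [measurable]: "?k h z \<in> borel_measurable \<mu>" for z
      by (rule borel_measurable_borel) measurable
    have "ennreal (norm (cesaro_integral s f z' - cesaro_integral s f z))
        = ennreal (norm (\<integral>t. ?F z' t - ?F z t \<partial>\<mu>))"
      using int by (simp add: cesaro_integral_def)
    also have "\<dots> \<le> (\<integral>\<^sup>+t. ennreal (norm (?F z' t - ?F z t)) \<partial>\<mu>)"
      using int by (intro integral_norm_bound_ennreal) auto
    also have "\<dots> \<le> (\<integral>\<^sup>+t. ennreal L * (ennreal (?k h z t) + ennreal (?k h z' t)) \<partial>\<mu>)"
    proof (rule nn_integral_mono)
      fix t assume "t \<in> space \<mu>"
      then have t: "t \<in> {0..<1}" by simp
      have "norm (?F z' t - ?F z t) \<le> L * (?k h z t + ?k h z' t)"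
        unfolding L_def using s f M t z d by (intro cesaro_kernel_diff_bound) auto
      moreover have "?k h w t \<ge> 0" for w
        using t h by simp
      ultimately show "ennreal (norm (?F z' t - ?F z t)) \<le> ennreal L * (ennreal (?k h z t) + ennreal (?k h z' t))"
        using L0 by (simp add: ennreal_leI flip: ennreal_plus ennreal_mult)
    qed
    also have "\<dots> = ennreal L * ((\<integral>\<^sup>+t. ennreal (?k h z t) \<partial>\<mu>) + (\<integral>\<^sup>+t. ennreal (?k h z' t) \<partial>\<mu>))"
      by (simp add: nn_integral_cmult nn_integral_add)
    also have "\<dots> \<le> ennreal L * (ennreal (C * ?G (h / norm (1 - z))) + ennreal (C * ?G (h / norm (1 - z'))))"
      using h z by (intro mult_left_mono add_mono C norm_one_minus_mult_ge) auto
    also have "\<dots> = ennreal (L * (C * ?G (h / norm (1 - z)) + C * ?G (h / norm (1 - z'))))"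
      using C L0 by (simp flip: ennreal_plus ennreal_mult)
    finally have "norm (cesaro_integral s f z' - cesaro_integral s f z)
        \<le> L * (C * ?G (h / norm (1 - z)) + C * ?G (h / norm (1 - z')))"
      using C L0 by (subst (asm) ennreal_le_iff) auto
    also have "\<dots> \<le> (L + 1) * (C * ?G (h / norm (1 - z)) + C * ?G (h / norm (1 - z')))"
      using C by (intro mult_right_mono) auto
    finally show "norm (cesaro_integral s f z' - cesaro_integral s f z)
        \<le> (L + 1) * C * (?G (h / norm (1 - z)) + ?G (h / norm (1 - z')))"
      by (simp add: algebra_simps)
  next
    fix r \<zeta> assume r: "0 \<le> (r :: real)" "r < 1" and \<zeta>: "norm \<zeta> = 1" "\<zeta> \<noteq> (1::complex)"
    let ?z = "of_real r * \<zeta>"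
    have z: "norm ?z < 1"
      using r \<zeta> by (simp add: norm_mult)
    then have "?z \<noteq> 1"
      by auto
    then have "ennreal (norm (cesaro_integral s f ?z))
        \<le> (\<integral>\<^sup>+t. ennreal (norm (cesaro_kernel s f (of_real t * ?z))) \<partial>\<mu>)"
      unfolding cesaro_integral_def using s f M z
      by (intro integral_norm_bound_ennreal integrable_cesaro_kernel) auto
    \<comment> \<open>With h = 1 the factor \<open>min 1 (h / (1 - t))\<close> equals 1, so the
      kernel bound for increments also controls the kernel itself.\<close>
    also have "\<dots> \<le> (\<integral>\<^sup>+t. ennreal L * ennreal (?k 1 ?z t) \<partial>\<mu>)"
    proof (rule nn_integral_mono)
      fix t assume "t \<in> space \<mu>"
      then have t: "t \<in> {0..<1}" by simp
      then have "min 1 (1 / (1 - t)) = 1"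
        by (auto simp: field_simps)
      moreover have "norm (cesaro_kernel s f (of_real t * ?z)) \<le> L * norm (1 - of_real t * ?z) powr (- s)"
        unfolding norm_cesaro_kernel
        using M[of "of_real t * ?z"] norm_mult_of_real_less_1[OF t, of ?z] z M_le_L
        by (intro mult_right_mono) auto
      ultimately show "ennreal (norm (cesaro_kernel s f (of_real t * ?z))) \<le> ennreal L * ennreal (?k 1 ?z t)"
        using L0 by (simp add: ennreal_leI flip: ennreal_mult)
    qed
    also have "\<dots> = ennreal L * (\<integral>\<^sup>+t. ennreal (?k 1 ?z t) \<partial>\<mu>)"
      by (intro nn_integral_cmult) measurable
    \<comment> \<open>Since t r lies in [0,1], d = |1 - \<zeta>| is admissible for every r; this
      makes the bound independent of the radius.\<close>
    also have "\<dots> \<le> ennreal L * ennreal (C * ?G (1 / norm (1 - \<zeta>)))"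
    proof (intro mult_left_mono C)
      fix t :: real assume "t \<in> {0..<1}"
      then have "t * r \<in> {0..1}"
        using r by (auto intro!: mult_le_one)
      then show "norm (1 - \<zeta>) / 2 \<le> norm (1 - of_real t * ?z)"
        using norm_one_minus_mult_ge[of "t * r" \<zeta>] \<zeta> by (simp add: mult.assoc)
    qed (use \<zeta> z in auto)
    also have "\<dots> = ennreal (L * (C * ?G (1 / norm (1 - \<zeta>))))"
      using C L0 by (simp flip: ennreal_mult)
    finally have "norm (cesaro_integral s f ?z) \<le> L * (C * ?G (1 / norm (1 - \<zeta>)))"
      using C L0 by (subst (asm) ennreal_le_iff) auto
    also have "\<dots> \<le> (L + 1) * (C * ?G (1 / norm (1 - \<zeta>)))"
      using C by (intro mult_right_mono) auto
    finally show "norm (cesaro_integral s f ?z) \<le> (L + 1) * C * ?G (1 / norm (1 - \<zeta>))"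
      by (simp add: mult.assoc)
  qed
qed

end

section \<open>Circle means and mean Lipschitz spaces\<close>

text \<open>The chord has length 2 |sin (x/2)|, and sin y >= y/3 on [0,2] because y - sin y <= y^3/6
  <= 4y/6.\<close>

lemma norm_one_minus_cis_ge:
  assumes "\<bar>x\<bar> \<le> pi"
  shows "\<bar>x\<bar> / 3 \<le> norm (1 - cis x)"
proof -
  have pos: "y / 3 \<le> sin y" if y: "0 \<le> y" "y \<le> 2" for y :: real
  proof -
    have "\<bar>sin y - y\<bar> \<le> y ^ 3 / 6"
      using Maclaurin_sin_bound[of y 3] y by (simp add: eval_nat_numeral sin_coeff_def)
    moreover have "y ^ 3 \<le> 4 * y"
      using y mult_mono[of y 2 y 2] mult_right_mono[of "y * y" 4 y] by (simp add: power3_eq_cube)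
    ultimately have "y - sin y \<le> 4 * y / 6"
      by linarith
    then show ?thesis
      by (simp add: field_simps)
  qed
  have "\<bar>x\<bar> / 2 \<le> 2"
    using assms pi_less_4 by simp
  then have "\<bar>x\<bar> / 2 / 3 \<le> sin (\<bar>x\<bar> / 2)"
    by (intro pos) auto
  also have "\<dots> \<le> \<bar>sin (x / 2)\<bar>"
    by (cases "x \<ge> 0") auto
  finally have "\<bar>x\<bar> / 3 \<le> 2 * \<bar>sin (x / 2)\<bar>"
    by simp
  then show ?thesis
    using dist_exp_i_1[of x] by (simp add: cis_conv_exp norm_minus_commute)
qed

text \<open>On [0, 3 pi] every x is within pi of 0 or of 2 pi, so one of the two terms majorizes by
  the chord estimate. This range accommodates \<theta> in [0, 2 pi] shifted by at most 1.\<close>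

lemma min_powr_le_sum:
  assumes "0 \<le> a" "0 \<le> b" "0 \<le> h" "0 \<le> x" "x \<le> 3 * pi"
  shows "min_powr a b (h / norm (1 - cis x))
    \<le> min_powr a b (3 * h / \<bar>x\<bar>) + min_powr a b (3 * h / \<bar>x - 2 * pi\<bar>)"
proof -
  have *: "min_powr a b (h / norm (1 - cis y)) \<le> min_powr a b (3 * h / \<bar>y\<bar>)" if "\<bar>y\<bar> \<le> pi" for y
  \<comment> \<open>At y = 0 both quotients are 0 by the convention for division by zero.\<close>
  proof (cases "y = 0")
    case False
    then have "h / norm (1 - cis y) \<le> h / (\<bar>y\<bar> / 3)"
      using norm_one_minus_cis_ge[OF that] assms by (intro divide_left_mono mult_pos_pos) auto
    then show ?thesis
      using assms by (intro min_powr_mono) (auto simp: mult.commute)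
  qed simp
  show ?thesis
  proof (cases "x \<le> pi")
    case True
    then have "min_powr a b (h / norm (1 - cis x)) \<le> min_powr a b (3 * h / \<bar>x\<bar>)"
      using assms by (intro *) auto
    then show ?thesis
      by (rule add_increasing2[rotated]) simp
  next
    case False
    then have "min_powr a b (h / norm (1 - cis (x - 2 * pi))) \<le> min_powr a b (3 * h / \<bar>x - 2 * pi\<bar>)"
      using assms by (intro *) auto
    moreover have "cis (x - 2 * pi) = cis x"
      by (simp flip: cis_divide)
    ultimately have "min_powr a b (h / norm (1 - cis x)) \<le> min_powr a b (3 * h / \<bar>x - 2 * pi\<bar>)"
      by simp
    then show ?thesis
      by (rule add_increasing[rotated]) simp
  qed
qed

text \<open>The substitution x = h x' reduces to h = 1, where a < 1 gives integrability at 0 and b >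
  1 at infinity. The majorant \<open>k\<close> lives on the positive half-line and is
  reflected.\<close>

lemma nn_integral_min_powr:
  assumes "0 \<le> a" "a < 1" "1 < b"
  obtains I where "0 < I" "\<And>h. 0 < h \<Longrightarrow>
    (\<integral>\<^sup>+x. ennreal (min_powr a b (h / \<bar>x\<bar>)) \<partial>lborel) \<le> ennreal (I * h)"
proof -
  define k where "k x = ennreal (indicator {0..1} x * x powr (- a)) + ennreal (indicator {1..} x * x powr (- b))"
    for x :: real
  have [measurable]: "k \<in> borel_measurable borel"
    unfolding k_def[abs_def] by measurable
  define I where "I = 1 / (1 - a) + 1 / (b - 1)"
  have I: "I > 0"
    using assms by (simp add: I_def add_pos_pos)
  have "(\<integral>\<^sup>+x. ennreal (indicator {0..1} x * x powr (- a)) \<partial>lborel) = ennreal (1 / (1 - a))"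
    using has_integral_powr_from_0[of "- a" 1] assms
    by (intro nn_integral_has_integral_lebesgue) auto
  moreover have "(\<integral>\<^sup>+x. ennreal (indicator {1..} x * x powr (- b)) \<partial>lborel) = ennreal (1 / (b - 1))"
  proof (intro nn_integral_has_integral_lebesgue)
    have "- (1 powr (- b + 1)) / (- b + 1) = 1 / (b - 1)"
      using assms by (simp add: field_simps)
    then show "((\<lambda>x. x powr (- b)) has_integral 1 / (b - 1)) {1..}"
      using has_integral_powr_to_inf[of "- b" 1] assms by simp
  qed auto
  ultimately have int_k: "(\<integral>\<^sup>+x. k x \<partial>lborel) = ennreal I"
    unfolding k_def I_def using assms by (subst nn_integral_add) (auto simp flip: ennreal_plus)
  have le_k: "ennreal (min_powr a b (1 / \<bar>x\<bar>)) \<le> k \<bar>x\<bar>" for x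
  proof (cases "\<bar>x\<bar> \<le> 1")
    case True
    then have "ennreal (min_powr a b (1 / \<bar>x\<bar>)) \<le> ennreal (indicator {0..1} \<bar>x\<bar> * \<bar>x\<bar> powr (- a))"
      by (intro ennreal_leI) (simp add: min_powr_def powr_divide powr_minus_divide)
    then show ?thesis
      unfolding k_def by (rule add_increasing2[rotated]) simp
  next
    case False
    then have "ennreal (min_powr a b (1 / \<bar>x\<bar>)) \<le> ennreal (indicator {1..} \<bar>x\<bar> * \<bar>x\<bar> powr (- b))"
      by (intro ennreal_leI) (simp add: min_powr_def powr_divide powr_minus_divide)
    then show ?thesis
      unfolding k_def by (rule add_increasing[rotated]) simp
  qed
  have int_1: "(\<integral>\<^sup>+x. ennreal (min_powr a b (1 / \<bar>x\<bar>)) \<partial>lborel) \<le> ennreal (2 * I)"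
  proof -
    have "(\<integral>\<^sup>+x. ennreal (min_powr a b (1 / \<bar>x\<bar>)) \<partial>lborel) \<le> (\<integral>\<^sup>+x. k x + k (- x) \<partial>lborel)"
    proof (rule nn_integral_mono)
      fix x :: real
      have "k \<bar>x\<bar> \<le> k x + k (- x)"
        by (cases "x \<ge> 0") (auto intro: add_increasing add_increasing2)
      then show "ennreal (min_powr a b (1 / \<bar>x\<bar>)) \<le> k x + k (- x)"
        using le_k[of x] by (rule order.trans[rotated])
    qed
    also have "\<dots> = (\<integral>\<^sup>+x. k x \<partial>lborel) + (\<integral>\<^sup>+x. k (- x) \<partial>lborel)"
      by (intro nn_integral_add) measurable
    also have "(\<integral>\<^sup>+x. k (- x) \<partial>lborel) = (\<integral>\<^sup>+x. k x \<partial>lborel)"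
      using nn_integral_real_affine[of k "-1" 0] by simp
    finally show ?thesis
      using I by (simp add: int_k flip: ennreal_plus)
  qed
  show thesis
  proof
    show "0 < 2 * I"
      using I by simp
    fix h :: real assume h: "0 < h"
    have "(\<integral>\<^sup>+x. ennreal (min_powr a b (h / \<bar>x\<bar>)) \<partial>lborel)
        = ennreal \<bar>h\<bar> * (\<integral>\<^sup>+x. ennreal (min_powr a b (h / \<bar>0 + h * x\<bar>)) \<partial>lborel)"
      using h by (intro nn_integral_real_affine) auto
    also have "(\<lambda>x. h / \<bar>0 + h * x\<bar>) = (\<lambda>x. 1 / \<bar>x\<bar>)"
      using h by (auto simp: abs_mult)
    also have "ennreal \<bar>h\<bar> * (\<integral>\<^sup>+x. ennreal (min_powr a b (1 / \<bar>x\<bar>)) \<partial>lborel) \<le> ennreal \<bar>h\<bar> * ennreal (2 * I)"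
      by (intro mult_left_mono int_1) auto
    also have "\<dots> = ennreal (2 * I * h)"
      using h I by (simp add: mult_ac flip: ennreal_mult)
    finally show "(\<integral>\<^sup>+x. ennreal (min_powr a b (h / \<bar>x\<bar>)) \<partial>lborel) \<le> ennreal (2 * I * h)" .
  qed
qed

text \<open>The factor 6 combines the two preimages 0 and 2 pi of the singular point with the chord
  constant 3. The shift by \<eta> serves the translated argument in the modulus of
  continuity.\<close>

lemma nn_integral_min_powr_circle:
  assumes "0 \<le> a" "a < 1" "1 < b"
  obtains I where "0 < I" "\<And>h \<eta>. \<lbrakk>0 < h; 0 \<le> \<eta>; \<eta> \<le> 1\<rbrakk> \<Longrightarrow>
    (\<integral>\<^sup>+\<theta>. ennreal (min_powr a b (h / norm (1 - cis (\<theta> + \<eta>)))) * indicator {0..2 * pi} \<theta> \<partial>lborel)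
      \<le> ennreal (I * h)"
proof -
  obtain I where I: "0 < I" "\<And>h. 0 < h \<Longrightarrow>
    (\<integral>\<^sup>+x. ennreal (min_powr a b (h / \<bar>x\<bar>)) \<partial>lborel) \<le> ennreal (I * h)"
    using nn_integral_min_powr[OF assms] by blast
  show thesis
  proof
    show "0 < 6 * I"
      using I by simp
    fix h \<eta> :: real assume h: "0 < h" and \<eta>: "0 \<le> \<eta>" "\<eta> \<le> 1"
    let ?f = "\<lambda>x. ennreal (min_powr a b (3 * h / \<bar>x\<bar>))"
    have shift: "(\<integral>\<^sup>+\<theta>. ?f (c + \<theta>) \<partial>lborel) = (\<integral>\<^sup>+x. ?f x \<partial>lborel)" for c
      using nn_integral_real_affine[of ?f 1 c] by simp
    have "(\<integral>\<^sup>+\<theta>. ennreal (min_powr a b (h / norm (1 - cis (\<theta> + \<eta>)))) * indicator {0..2 * pi} \<theta> \<partial>lborel)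
        \<le> (\<integral>\<^sup>+\<theta>. ?f (\<eta> + \<theta>) + ?f ((\<eta> - 2 * pi) + \<theta>) \<partial>lborel)"
    proof (rule nn_integral_mono)
      fix \<theta> :: real
      have "ennreal (min_powr a b (h / norm (1 - cis (\<theta> + \<eta>)))) \<le> ?f (\<theta> + \<eta>) + ?f (\<theta> + \<eta> - 2 * pi)"
        if "\<theta> \<in> {0..2 * pi}"
        using min_powr_le_sum[of a b h "\<theta> + \<eta>"] that h \<eta> assms pi_gt3
        by (simp add: ennreal_leI flip: ennreal_plus)
      then show "ennreal (min_powr a b (h / norm (1 - cis (\<theta> + \<eta>)))) * indicator {0..2 * pi} \<theta>
          \<le> ?f (\<eta> + \<theta>) + ?f ((\<eta> - 2 * pi) + \<theta>)"
        by (auto simp: indicator_def algebra_simps)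
    qed
    also have "\<dots> = (\<integral>\<^sup>+x. ?f x \<partial>lborel) + (\<integral>\<^sup>+x. ?f x \<partial>lborel)"
      by (subst nn_integral_add) (simp_all only: shift, measurable)
    also have "\<dots> \<le> ennreal (I * (3 * h)) + ennreal (I * (3 * h))"
      using h by (intro add_mono I) auto
    also have "\<dots> = ennreal (6 * I * h)"
      using I h by (simp flip: ennreal_plus)
    finally show "(\<integral>\<^sup>+\<theta>. ennreal (min_powr a b (h / norm (1 - cis (\<theta> + \<eta>)))) * indicator {0..2 * pi} \<theta> \<partial>lborel)
      \<le> ennreal (6 * I * h)" .
  qed
qed

section \<open>Exceptional angles, circle norms and boundary functions\<close>

lemma borel_measurable_cis [measurable]: "cis \<in> borel_measurable borel"
  by (intro borel_measurable_continuous_onI continuous_intros)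

lemma AE_cis_neq_1: "AE \<theta> in lborel. cis (\<theta> + \<eta>) \<noteq> 1"
proof -
  have "countable {\<theta>. cis (\<theta> + \<eta>) = 1}"
  proof (rule countable_subset)
    show "{\<theta>. cis (\<theta> + \<eta>) = 1} \<subseteq> range (\<lambda>n :: int. of_int n * (2 * pi) - \<eta>)"
    proof
      fix \<theta> assume "\<theta> \<in> {\<theta>. cis (\<theta> + \<eta>) = 1}"
      then have "cos (\<theta> + \<eta>) = 1"
        by (simp add: complex_eq_iff)
      then obtain n :: int where "\<theta> + \<eta> = of_int n * 2 * pi"
        using cos_one_2pi_int by blast
      then show "\<theta> \<in> range (\<lambda>n :: int. of_int n * (2 * pi) - \<eta>)"
        by (auto simp: algebra_simps intro!: image_eqI[of _ _ n])
    qed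
  qed simp
  then have "{\<theta>. cis (\<theta> + \<eta>) = 1} \<in> null_sets lborel"
    by (rule countable_imp_null_set_lborel)
  then show ?thesis
    by (auto dest: AE_not_in)
qed

text \<open>The Bochner integral is 0 by default for a non-integrable function and otherwise bounded
  by the nonnegative integral, so an almost-everywhere majorant controls it for any F. The factor
  1/(2 pi) is estimated by 1.\<close>

lemma circle_norm_le:
  assumes "1 \<le> p" "0 \<le> c"
    and "AE \<theta> in lborel. \<theta> \<in> {0..2 * pi} \<longrightarrow> ennreal (norm (F (cis \<theta>)) powr p) \<le> R \<theta>"
    and "(\<integral>\<^sup>+\<theta>. R \<theta> * indicator {0..2 * pi} \<theta> \<partial>lborel) \<le> ennreal c"
  shows "circle_norm p F \<le> c powr (1 / p)"
proof -
  let ?J = "LINT \<theta>:{0..2 * pi}|lebesgue. norm (F (cis \<theta>)) powr p"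
  have "(\<integral>\<^sup>+\<theta>. ennreal (indicator {0..2 * pi} \<theta> *\<^sub>R norm (F (cis \<theta>)) powr p) \<partial>lborel)
      \<le> (\<integral>\<^sup>+\<theta>. R \<theta> * indicator {0..2 * pi} \<theta> \<partial>lborel)"
    by (rule nn_integral_mono_AE) (use assms(3) in \<open>eventually_elim, auto simp: indicator_def\<close>)
  then have J: "?J \<le> c"
    unfolding set_lebesgue_integral_def using assms
    by (intro integral_real_bounded) (auto simp: nn_integral_completion intro: order.trans)
  have J0: "?J \<ge> 0"
    unfolding set_lebesgue_integral_def by (intro integral_nonneg_AE) auto
  have "1 / (2 * pi) * ?J \<le> 1 * ?J"
    using J0 pi_gt3 by (intro mult_right_mono) (auto simp: field_simps)
  then show ?thesis
    unfolding circle_norm_def using J J0 assms by (intro powr_mono2) auto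
qed

lemma circle_norm_nonneg [simp]: "0 \<le> circle_norm p F"
  by (simp add: circle_norm_def)

text \<open>The radial points (1 - \<delta>) \<zeta> lie in the Stolz region of aperture 2, so
  \<zeta> is a limit point of that region. This makes the definite description in
  \<open>boundary_fun\<close> meaningful.\<close>

lemma nontangential_limit_unique:
  assumes "norm \<zeta> = 1" "nontangential_limit f \<zeta> L" "nontangential_limit f \<zeta> L'"
  shows "L = L'"
proof -
  have "\<zeta> islimpt stolz_region 2 \<zeta>"
    unfolding islimpt_approachable
  proof (intro allI impI)
    fix e :: real assume e: "e > 0"
    define \<delta> where "\<delta> = min 1 (e / 2)"
    have \<delta>: "0 < \<delta>" "\<delta> \<le> 1" "\<delta> < e"
      using e by (auto simp: \<delta>_def)
    let ?z = "of_real (1 - \<delta>) * \<zeta>"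
    have z: "norm ?z = 1 - \<delta>"
      using \<delta> assms(1) by (simp only: norm_mult norm_of_real) simp
    have "?z - \<zeta> = - (of_real \<delta> * \<zeta>)"
      by (simp add: algebra_simps)
    then have d: "norm (?z - \<zeta>) = \<delta>"
      using \<delta> assms(1) by (simp only: norm_minus_cancel norm_mult norm_of_real)
    have "?z \<in> stolz_region 2 \<zeta>"
      unfolding stolz_region_def mem_Collect_eq z d using \<delta> by simp
    moreover have "?z \<noteq> \<zeta>"
      using d \<delta> by auto
    moreover have "dist ?z \<zeta> < e"
      unfolding dist_norm d by (rule \<delta>)
    ultimately show "\<exists>x'\<in>stolz_region 2 \<zeta>. x' \<noteq> \<zeta> \<and> dist x' \<zeta> < e"
      by blast
  qed
  moreover have "(f \<longlongrightarrow> L) (at \<zeta> within stolz_region 2 \<zeta>)" "(f \<longlongrightarrow> L') (at \<zeta> within stolz_region 2 \<zeta>)"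
    using assms(2,3) by (auto simp: nontangential_limit_def)
  ultimately show ?thesis
    by (intro tendsto_unique) (auto simp: trivial_limit_within)
qed

lemma boundary_fun_eqI:
  "norm \<zeta> = 1 \<Longrightarrow> nontangential_limit f \<zeta> L \<Longrightarrow> boundary_fun f \<zeta> = L"
  unfolding boundary_fun_def by (blast intro: nontangential_limit_unique)

lemma powr_sum_le:
  fixes x y p :: real
  assumes "0 \<le> x" "0 \<le> y" "0 \<le> p"
  shows "(x + y) powr p \<le> 2 powr p * (x powr p + y powr p)"
proof -
  have "(x + y) powr p \<le> (2 * max x y) powr p"
    using assms by (intro powr_mono2) auto
  also have "\<dots> = 2 powr p * max x y powr p"
    by (rule powr_mult)
  also have "\<dots> \<le> 2 powr p * (x powr p + y powr p)"
    by (intro mult_left_mono) (auto simp: max_def)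
  finally show ?thesis .
qed

section \<open>Sufficiency: images of bounded functions are mean Lipschitz\<close>

context finite_Ico01_measure
begin

lemma nontangential_limit_cesaro_op:
  assumes s: "0 < s" and f: "f \<in> H_disc" and M: "\<And>z. norm z < 1 \<Longrightarrow> norm (f z) \<le> M"
    and \<zeta>: "norm \<zeta> = 1" "\<zeta> \<noteq> 1"
  shows "nontangential_limit (cesaro_op \<mu> s f) \<zeta> (cesaro_integral s f \<zeta>)"
  unfolding nontangential_limit_def
proof (intro allI impI)
  fix A :: real
  have sub: "stolz_region A \<zeta> \<subseteq> ball 0 1"
    by (auto simp: stolz_region_def)
  have "(cesaro_integral s f \<longlongrightarrow> cesaro_integral s f \<zeta>) (at \<zeta> within stolz_region A \<zeta>)"
    using tendsto_cesaro_integral[OF s f M \<zeta>] sub by (rule tendsto_within_subset)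
  moreover have "\<forall>\<^sub>F z in at \<zeta> within stolz_region A \<zeta>. cesaro_op \<mu> s f z = cesaro_integral s f z"
    unfolding eventually_at_filter using sub cesaro_op_eq_integral[OF s f]
    by (intro always_eventually) auto
  ultimately show "(cesaro_op \<mu> s f \<longlongrightarrow> cesaro_integral s f \<zeta>) (at \<zeta> within stolz_region A \<zeta>)"
    by (simp add: tendsto_cong)
qed

text \<open>All three defining conditions come from the integral: the growth bound gives the Hardy
  norm, its boundary limits give the boundary function off the point 1, and the increment bound
  gives the modulus.\<close>

lemma cesaro_op_mean_lipschitz:
  assumes s: "0 < s" and p: "max 1 (1 / s) < p" and carl: "carleson_measure s \<mu>"
    and f: "f \<in> H_infinity"
  shows "cesaro_op \<mu> s f \<in> mean_lipschitz p (1 / p)"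
proof -
  let ?g = "cesaro_op \<mu> s f" and ?I = "cesaro_integral s f"
  have fH: "f \<in> H_disc"
    using f by (simp add: H_infinity_def)
  obtain M where M: "\<And>z. norm z < 1 \<Longrightarrow> norm (f z) \<le> M"
    using f by (force simp: H_infinity_def bounded_iff)
  have p1: "1 < p"
    using p by simp
  have "1 / p < min 1 s"
    using p s by (auto simp: field_simps)
  then obtain \<tau> where \<tau>: "1 / p < \<tau>" "\<tau> < 1" "\<tau> < s"
    using dense[of "1 / p" "min 1 s"] by auto
  \<comment> \<open>After raising to the power p the exponents become \<sigma> p = 1/2 < 1 and
    \<tau> p > 1, as required for the integral over the circle to be of order h.\<close>
  define \<sigma> where "\<sigma> = 1 / (2 * p)"
  have \<sigma>: "0 < \<sigma>" "\<sigma> < \<tau>" "\<sigma> * p = 1 / 2"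
  proof -
    have "1 / (2 * p) < 1 / p"
      using p1 by (simp add: field_simps)
    then show "0 < \<sigma>" "\<sigma> < \<tau>" "\<sigma> * p = 1 / 2"
      using p1 \<tau> by (auto simp: \<sigma>_def)
  qed
  have \<tau>p: "1 < \<tau> * p"
    using \<tau> p1 by (simp add: field_simps)
  let ?\<psi> = "min_powr (\<sigma> * p) (\<tau> * p)"
  have \<psi>: "min_powr \<sigma> \<tau> q powr p = ?\<psi> q" for q
    using p1 by (intro min_powr_powr) auto
  obtain C where C: "0 < C"
    "\<And>h z z'. \<lbrakk>0 < h; norm z \<le> 1; norm z' \<le> 1; z \<noteq> 1; z' \<noteq> 1; norm (z' - z) \<le> h\<rbrakk> \<Longrightarrow>
      norm (?I z' - ?I z) \<le> C * (min_powr \<sigma> \<tau> (h / norm (1 - z)) + min_powr \<sigma> \<tau> (h / norm (1 - z')))"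
    "\<And>r \<zeta>. \<lbrakk>0 \<le> r; r < 1; norm \<zeta> = 1; \<zeta> \<noteq> 1\<rbrakk> \<Longrightarrow>
      norm (?I (of_real r * \<zeta>)) \<le> C * min_powr \<sigma> \<tau> (1 / norm (1 - \<zeta>))"
    using cesaro_integral_bounds[OF carl \<sigma>(1,2) \<tau>(2,3) fH M] by blast
  obtain J where J: "0 < J" "\<And>h \<eta>. \<lbrakk>0 < h; 0 \<le> \<eta>; \<eta> \<le> 1\<rbrakk> \<Longrightarrow>
      (\<integral>\<^sup>+\<theta>. ennreal (?\<psi> (h / norm (1 - cis (\<theta> + \<eta>)))) * indicator {0..2 * pi} \<theta> \<partial>lborel) \<le> ennreal (J * h)"
    using nn_integral_min_powr_circle[of "\<sigma> * p" "\<tau> * p"] \<sigma> \<tau>p by auto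
  have hardy: "?g \<in> hardy p"
    unfolding hardy_def
  proof (intro CollectI conjI bdd_aboveI2)
    show "?g \<in> H_disc"
      using s fH by (rule cesaro_op_H_disc)
    fix r :: real assume "r \<in> {0<..<1}"
    then have r: "0 \<le> r" "r < 1" by auto
    let ?R = "\<lambda>\<theta>. ennreal (C powr p) * ennreal (?\<psi> (1 / norm (1 - cis (\<theta> + 0))))"
    show "integral_mean p r ?g \<le> (C powr p * J) powr (1 / p)"
      unfolding integral_mean_def
    proof (rule circle_norm_le)
      show "AE \<theta> in lborel. \<theta> \<in> {0..2 * pi} \<longrightarrow> ennreal (norm (?g (of_real r * cis \<theta>)) powr p) \<le> ?R \<theta>"
        using AE_cis_neq_1[of 0]
      proof (eventually_elim, intro impI)
        fix \<theta> assume "cis (\<theta> + 0) \<noteq> 1" "\<theta> \<in> {0..2 * pi}"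
        then have "norm (?I (of_real r * cis \<theta>)) \<le> C * min_powr \<sigma> \<tau> (1 / norm (1 - cis \<theta>))"
          using r by (intro C) auto
        then have "norm (?I (of_real r * cis \<theta>)) powr p \<le> (C * min_powr \<sigma> \<tau> (1 / norm (1 - cis \<theta>))) powr p"
          using p1 by (intro powr_mono2) auto
        also have "\<dots> = C powr p * ?\<psi> (1 / norm (1 - cis \<theta>))"
          by (simp add: powr_mult \<psi>)
        finally show "ennreal (norm (?g (of_real r * cis \<theta>)) powr p) \<le> ?R \<theta>"
          using r by (simp add: cesaro_op_eq_integral[OF s fH] norm_mult ennreal_leI flip: ennreal_mult)
      qed
      have "(\<integral>\<^sup>+\<theta>. ?R \<theta> * indicator {0..2 * pi} \<theta> \<partial>lborel)
          = ennreal (C powr p) * (\<integral>\<^sup>+\<theta>. ennreal (?\<psi> (1 / norm (1 - cis (\<theta> + 0)))) * indicator {0..2 * pi} \<theta> \<partial>lborel)"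
        unfolding mult.assoc by (intro nn_integral_cmult) measurable
      also have "\<dots> \<le> ennreal (C powr p) * ennreal (J * 1)"
        by (intro mult_left_mono J) auto
      finally show "(\<integral>\<^sup>+\<theta>. ?R \<theta> * indicator {0..2 * pi} \<theta> \<partial>lborel) \<le> ennreal (C powr p * J)"
        using J by (simp flip: ennreal_mult)
    qed (use p1 J in auto)
  qed
  have ntl: "nontangential_limit ?g (cis \<phi>) (?I (cis \<phi>))" if "cis \<phi> \<noteq> 1" for \<phi>
    using s fH M that by (intro nontangential_limit_cesaro_op) auto
  then have bdry: "boundary_fun ?g (cis \<phi>) = ?I (cis \<phi>)" if "cis \<phi> \<noteq> 1" for \<phi>
    using that by (intro boundary_fun_eqI) auto
  have "AE \<theta> in lebesgue. cis (\<theta> + 0) \<noteq> 1"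
    by (intro AE_completion AE_cis_neq_1)
  then have ae: "AE \<theta> in lebesgue. \<exists>L. nontangential_limit ?g (cis \<theta>) L"
    by eventually_elim (use ntl in auto)
  define K where "K = ((2 * C) powr p * (2 * J)) powr (1 / p)"
  \<comment> \<open>The p-th power of the increment integrates to order h, once around each of the
    singular angles of \<theta> and of \<theta> + h, and the p-th root gives order 1/p. The
    restriction h <= 1 matches the range of the shift.\<close>
  have diff: "circle_norm p (\<lambda>\<zeta>. boundary_fun ?g (\<zeta> * cis h) - boundary_fun ?g \<zeta>) \<le> K * h powr (1 / p)"
    if h: "0 < h" "h \<le> 1" for h
  proof -
    let ?Q = "\<lambda>\<eta> \<theta>. ennreal (?\<psi> (h / norm (1 - cis (\<theta> + \<eta>))))"
    let ?R = "\<lambda>\<theta>. ennreal ((2 * C) powr p) * (?Q 0 \<theta> + ?Q h \<theta>)"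
    have "circle_norm p (\<lambda>\<zeta>. boundary_fun ?g (\<zeta> * cis h) - boundary_fun ?g \<zeta>)
        \<le> ((2 * C) powr p * (2 * J * h)) powr (1 / p)"
    proof (rule circle_norm_le)
      show "AE \<theta> in lborel. \<theta> \<in> {0..2 * pi} \<longrightarrow>
          ennreal (norm (boundary_fun ?g (cis \<theta> * cis h) - boundary_fun ?g (cis \<theta>)) powr p) \<le> ?R \<theta>"
        using AE_cis_neq_1[of 0] AE_cis_neq_1[of h]
      proof (eventually_elim, intro impI)
        fix \<theta> assume "cis (\<theta> + 0) \<noteq> 1" "cis (\<theta> + h) \<noteq> 1"
        then have ne: "cis \<theta> \<noteq> 1" "cis (\<theta> + h) \<noteq> 1"
          by auto
        \<comment> \<open>The chord is no longer than the arc h, so h is admissible in the increment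
          bound.\<close>
        have "norm (cis (\<theta> + h) - cis \<theta>) = norm (cis \<theta> * (cis h - 1))"
          by (simp add: algebra_simps flip: cis_mult)
        also have "\<dots> = 2 * \<bar>sin (h / 2)\<bar>"
          using dist_exp_i_1[of h] by (simp add: norm_mult cis_conv_exp)
        also have "\<dots> \<le> h"
          using abs_sin_x_le_abs_x[of "h / 2"] h by simp
        finally have "norm (?I (cis (\<theta> + h)) - ?I (cis \<theta>))
            \<le> C * (min_powr \<sigma> \<tau> (h / norm (1 - cis \<theta>)) + min_powr \<sigma> \<tau> (h / norm (1 - cis (\<theta> + h))))"
          using h ne by (intro C) auto
        then have "norm (?I (cis (\<theta> + h)) - ?I (cis \<theta>)) powr p
            \<le> (C * (min_powr \<sigma> \<tau> (h / norm (1 - cis \<theta>)) + min_powr \<sigma> \<tau> (h / norm (1 - cis (\<theta> + h))))) powr p"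
          using p1 by (intro powr_mono2) auto
        also have "\<dots> \<le> C powr p * (2 powr p * (?\<psi> (h / norm (1 - cis \<theta>)) + ?\<psi> (h / norm (1 - cis (\<theta> + h)))))"
          unfolding powr_mult[of C] \<psi>[symmetric] using p1 by (intro mult_left_mono powr_sum_le) auto
        also have "\<dots> = (2 * C) powr p * (?\<psi> (h / norm (1 - cis \<theta>)) + ?\<psi> (h / norm (1 - cis (\<theta> + h))))"
          by (simp add: powr_mult)
        finally show "ennreal (norm (boundary_fun ?g (cis \<theta> * cis h) - boundary_fun ?g (cis \<theta>)) powr p) \<le> ?R \<theta>"
          using ne by (simp add: cis_mult bdry ennreal_leI flip: ennreal_plus ennreal_mult)
      qed
      have "(\<integral>\<^sup>+\<theta>. ?R \<theta> * indicator {0..2 * pi} \<theta> \<partial>lborel)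
          = (\<integral>\<^sup>+\<theta>. ennreal ((2 * C) powr p) * (?Q 0 \<theta> * indicator {0..2 * pi} \<theta> + ?Q h \<theta> * indicator {0..2 * pi} \<theta>) \<partial>lborel)"
        by (simp add: distrib_right mult.assoc)
      also have "\<dots> = ennreal ((2 * C) powr p) * ((\<integral>\<^sup>+\<theta>. ?Q 0 \<theta> * indicator {0..2 * pi} \<theta> \<partial>lborel)
          + (\<integral>\<^sup>+\<theta>. ?Q h \<theta> * indicator {0..2 * pi} \<theta> \<partial>lborel))"
        by (subst nn_integral_cmult, measurable, subst nn_integral_add) measurable
      also have "\<dots> \<le> ennreal ((2 * C) powr p) * (ennreal (J * h) + ennreal (J * h))"
        using h by (intro mult_left_mono add_mono J) auto
      also have "\<dots> = ennreal ((2 * C) powr p * (2 * J * h))"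
        using J h by (simp flip: ennreal_plus ennreal_mult)
      finally show "(\<integral>\<^sup>+\<theta>. ?R \<theta> * indicator {0..2 * pi} \<theta> \<partial>lborel) \<le> ennreal ((2 * C) powr p * (2 * J * h))" .
    qed (use p1 J h in auto)
    also have "\<dots> = K * h powr (1 / p)"
      by (simp add: K_def flip: powr_mult mult.assoc)
    finally show ?thesis .
  qed
  have K0: "K \<ge> 0"
    by (simp add: K_def)
  have "\<bar>integral_modulus p t ?g\<bar> \<le> K * \<bar>t powr (1 / p)\<bar>" if t: "0 < t" "t < 1" for t
  proof -
    let ?N = "\<lambda>h. circle_norm p (\<lambda>\<zeta>. boundary_fun ?g (\<zeta> * cis h) - boundary_fun ?g \<zeta>)"
    have le: "?N h \<le> K * t powr (1 / p)" if "h \<in> {0<..t}" for h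
    proof -
      have "?N h \<le> K * h powr (1 / p)"
        using that t by (intro diff) auto
      also have "\<dots> \<le> K * t powr (1 / p)"
        using that K0 p1 by (intro mult_left_mono powr_mono2) auto
      finally show ?thesis .
    qed
    have "integral_modulus p t ?g \<le> K * t powr (1 / p)"
      unfolding integral_modulus_def using t le by (intro cSUP_least) auto
    \<comment> \<open>The Landau bound concerns absolute values. The supremum dominates the
      nonnegative value at h = t, which on the reals requires the family to be bounded
      above.\<close>
    moreover have "0 \<le> integral_modulus p t ?g"
      unfolding integral_modulus_def using t le
      by (intro cSUP_upper2[where x = t]) (auto intro!: bdd_aboveI2[where M = "K * t powr (1 / p)"])
    ultimately show ?thesis by simp
  qed
  then have "(\<lambda>t. integral_modulus p t ?g) \<in> O[at_right 0](\<lambda>t. t powr (1 / p))"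
    by (intro bigoI[where c = K] eventually_at_rightI[of 0 1]) auto
  with hardy ae show ?thesis
    by (simp add: mean_lipschitz_def)
qed

end

theorem theorem4p2:
  fixes s p :: real and \<mu> :: "real measure" and X :: "(complex \<Rightarrow> complex) set"
  assumes "0 < s"
    and "borel_measure_Ico01 \<mu>" and "finite_measure \<mu>"
    and "max 1 (1 / s) < p"
    and "complex_subspace X" and "X \<subseteq> H_disc"
    and "mean_lipschitz p (1 / p) \<subseteq> X" and "X \<subseteq> bloch"
  shows "cesaro_op \<mu> s ` H_infinity \<subseteq> X \<longleftrightarrow> carleson_measure s \<mu>"
proof -
  interpret finite_measure \<mu>
    by fact
  interpret finite_Ico01_measure \<mu>
    by unfold_locales fact
  show ?thesis
  proof
    \<comment> \<open>The constant 1 is the test function, and the inclusion of X in the Bloch space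
      carries its image there. The converse passes through the mean Lipschitz space into X.\<close>
    assume "cesaro_op \<mu> s ` H_infinity \<subseteq> X"
    moreover have "(\<lambda>z. 1) \<in> H_infinity"
      by (simp add: H_infinity_def H_disc_def bounded_iff) auto
    ultimately have "cesaro_op \<mu> s (\<lambda>z. 1) \<in> bloch"
      using assms(8) by blast
    with assms(1) show "carleson_measure s \<mu>"
      by (rule carleson_if_bloch)
  next
    assume "carleson_measure s \<mu>"
    then show "cesaro_op \<mu> s ` H_infinity \<subseteq> X"
      using cesaro_op_mean_lipschitz[OF assms(1,4)] assms(7) by blast
  qed
qed

end
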